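(* Let $X$ be an infinite set and $\Sigma$ a non-empty finite subset of $X$. Then the maximal subsemigroups of $I_X$ which contain the pointwise stabiliser $\operatorname{Sym}(X)_{(\Sigma)}$ but not $\operatorname{Sym}(X)$ are exactly $$P_{\Gamma,\mu} =\{f \in I_X : c(f) \geq \mu \text{ or } \Gamma \nsubseteq \operatorname{dom}(f) \text{ or } (\Gamma f = \Gamma \text{ and } d(f) < \mu)\} \cup \mathfrak{F},$$ $$P_{\Gamma,\mu}^{-1} =\{f \in I_X : d(f) \geq \mu \text{ or } \Gamma \nsubseteq \operatorname{im}(f) \text{ or } (\Gamma f = \Gamma \text{ and } c(f) < \mu)\} \cup \mathfrak{F},$$ where $\Gamma$ is a non-empty subset of $\Sigma$ and $\mu$ is an infinite cardinal with $\mu \leq |X|^+$. The maximal inverse subsemigroups of $I_X$ containing $\operatorname{Sym}(X)_{(\Sigma)}$ but not $\operatorname{Sym}(X)$ are exactly $$\begin{aligned} P_{\Gamma, \mu} \cap P_{\Gamma, \mu}^{-1} = \{ f \in I_X :\ &(\Gamma \nsubseteq \operatorname{dom}(f) \text{ and } \Gamma \nsubseteq \operatorname{im}(f)) \text{ or } (\Gamma \nsubseteq \operatorname{dom}(f) \text{ and } d(f)\geq \mu) \text{ or } \\ &( c(f)\geq \mu \text{ and } \Gamma \nsubseteq \operatorname{im}(f)) \text{ or } (c(f)\geq \mu \text{ and }d(f)\geq \mu) \text{ or } \\ &(\Gamma f = \Gamma \text{ and } c(f)+d(f) < \mu)\} \cup \mathfrak{F}\end{aligned}$$ over the same values of $\Gamma$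 and $\mu$.
   Context: $I_X$ denotes the symmetric inverse monoid on $X$: the set of all injective partial functions from $X$ to $X$ (bijections between subsets of $X$, including the empty one) under composition of partial functions, written on the right and composed from left to right. $\operatorname{Sym}(X)\subseteq I_X$ is the group of all permutations of $X$, and $\operatorname{Sym}(X)_{(\Sigma)}=\{f\in\operatorname{Sym}(X): xf=x \text{ for all } x\in\Sigma\}$. For $f\in I_X$: $c(f)=|X\setminus \operatorname{dom}(f)|$ (collapse), $d(f)=|X\setminus\operatorname{im}(f)|$ (defect), $r(f)=|\operatorname{im}(f)|$ (rank). For $\Gamma\subseteq X$, $\Gamma f=\{xf: x\in\Gamma\cap\operatorname{dom}(f)\}$. $\mathfrak{F}=\{f\in I_X: r(f)<|X|\}$. $|X|^+$ is the successor cardinal of $|X|$. For $M\subseteq I_X$, $M^{-1}=\{f^{-1}:f\in M\}$. An inverse subsemigroup is a subsemigroup closed under $f\mapsto f^{-1}$. A maximal subsemigroup (respectively maximal inverse subsemigroup) is a maximal element, under containment, of the set of all proper subsemigroups (respectively proper inverse subsemigroups). *)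

theory Defs
  imports Main
begin

unbundle cardinal_syntax

text \<open>
  Partial functions on \<open>X\<close> are maps \<open>'a \<rightharpoonup> 'a\<close> whose domain and range lie in the carrier
  set \<open>X\<close>.  Functions are written on the right and composed from left to right, so the
  product \<open>f \<cdot> g\<close> (first \<open>f\<close>, then \<open>g\<close>) is \<open>g \<circ>\<^sub>m f\<close>.
\<close>

definition sym_inv_monoid :: "'a set \<Rightarrow> ('a \<rightharpoonup> 'a) set" where
  "sym_inv_monoid X = {f. dom f \<subseteq> X \<and> ran f \<subseteq> X \<and> inj_on f (dom f)}"

definition pcomp :: "('a \<rightharpoonup> 'a) \<Rightarrow> ('a \<rightharpoonup> 'a) \<Rightarrow> ('a \<rightharpoonup> 'a)" (infixl "\<cdot>" 70) where
  "f \<cdot> g = g \<circ>\<^sub>m f"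

definition pinv :: "('a \<rightharpoonup> 'a) \<Rightarrow> ('a \<rightharpoonup> 'a)" where
  "pinv f = (\<lambda>y. if y \<in> ran f then Some (THE x. f x = Some y) else None)"

definition pimage :: "('a \<rightharpoonup> 'a) \<Rightarrow> 'a set \<Rightarrow> 'a set" where
  "pimage f \<Gamma> = {the (f x) | x. x \<in> \<Gamma> \<inter> dom f}"

definition sym_group :: "'a set \<Rightarrow> ('a \<rightharpoonup> 'a) set" where
  "sym_group X = {f \<in> sym_inv_monoid X. dom f = X \<and> ran f = X}"

definition pointwise_stabiliser :: "'a set \<Rightarrow> 'a set \<Rightarrow> ('a \<rightharpoonup> 'a) set" where
  "pointwise_stabiliser X \<Sigma> = {f \<in> sym_group X. \<forall>x\<in>\<Sigma>. f x = Some x}"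

text \<open>
  Cardinals are well-orders of minimal type, compared up to order isomorphism by
  \<open>\<le>o\<close> and \<open><o\<close>; \<open>|A|\<close> is the cardinality of \<open>A\<close> and \<open>+c\<close> is the cardinal sum.
\<close>

definition collapse :: "'a set \<Rightarrow> ('a \<rightharpoonup> 'a) \<Rightarrow> 'a rel" where
  "collapse X f = |X - dom f|"

definition defect :: "'a set \<Rightarrow> ('a \<rightharpoonup> 'a) \<Rightarrow> 'a rel" where
  "defect X f = |X - ran f|"

definition rank :: "('a \<rightharpoonup> 'a) \<Rightarrow> 'a rel" where
  "rank f = |ran f|"

definition small_rank :: "'a set \<Rightarrow> ('a \<rightharpoonup> 'a) set" where
  "small_rank X = {f \<in> sym_inv_monoid X. rank f <o |X|}"

definition subsemigroup :: "'a set \<Rightarrow> ('a \<rightharpoonup> 'a) set \<Rightarrow> bool" where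
  "subsemigroup X M \<longleftrightarrow> M \<subseteq> sym_inv_monoid X \<and> (\<forall>f\<in>M. \<forall>g\<in>M. f \<cdot> g \<in> M)"

definition inverse_subsemigroup :: "'a set \<Rightarrow> ('a \<rightharpoonup> 'a) set \<Rightarrow> bool" where
  "inverse_subsemigroup X M \<longleftrightarrow> subsemigroup X M \<and> (\<forall>f\<in>M. pinv f \<in> M)"

definition maximal_element :: "'b set set \<Rightarrow> 'b set \<Rightarrow> bool" where
  "maximal_element \<C> M \<longleftrightarrow> M \<in> \<C> \<and> (\<forall>N\<in>\<C>. M \<subseteq> N \<longrightarrow> N = M)"

definition maximal_subsemigroup :: "'a set \<Rightarrow> ('a \<rightharpoonup> 'a) set \<Rightarrow> bool" where
  "maximal_subsemigroup X =
     maximal_element {M. subsemigroup X M \<and> M \<noteq> sym_inv_monoid X}"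

definition maximal_inverse_subsemigroup :: "'a set \<Rightarrow> ('a \<rightharpoonup> 'a) set \<Rightarrow> bool" where
  "maximal_inverse_subsemigroup X =
     maximal_element {M. inverse_subsemigroup X M \<and> M \<noteq> sym_inv_monoid X}"

definition P_set :: "'a set \<Rightarrow> 'a set \<Rightarrow> 'b rel \<Rightarrow> ('a \<rightharpoonup> 'a) set" where
  "P_set X \<Gamma> \<mu> =
     {f \<in> sym_inv_monoid X.
        \<mu> \<le>o collapse X f \<or> \<not> \<Gamma> \<subseteq> dom f \<or> (pimage f \<Gamma> = \<Gamma> \<and> defect X f <o \<mu>)}
     \<union> small_rank X"

text \<open>
  The cardinal \<open>\<mu>\<close> ranges over cardinals on the type \<open>'a set\<close>, the type of
  \<open>cardSuc |X|\<close>.  By \<open>cardinal_representative\<close> below this omits no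
  cardinal \<open>\<mu> \<le> |X|\<^sup>+\<close>; representatives need not be unique.
\<close>

definition admissible :: "'a set \<Rightarrow> 'a set \<Rightarrow> 'a set \<Rightarrow> 'a set rel \<Rightarrow> bool" where
  "admissible X \<Sigma> \<Gamma> \<mu> \<longleftrightarrow>
     \<Gamma> \<noteq> {} \<and> \<Gamma> \<subseteq> \<Sigma> \<and> Card_order \<mu> \<and> cinfinite \<mu> \<and> \<mu> \<le>o cardSuc |X|"

lemma cardinal_representative:
  fixes \<nu> :: "'b rel" and X :: "'a set"
  assumes "Card_order \<nu>" and "\<nu> \<le>o cardSuc |X|"
  shows "\<exists>\<mu> :: 'a set rel. Card_order \<mu> \<and> \<nu> =o \<mu>"
  using assms internalize_ordLeq[of \<nu> "cardSuc |X|"] Card_order_ordIso ordIso_symmetric by metis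

lemma pinv_eq_Some_iff:
  assumes "f \<in> sym_inv_monoid X"
  shows "pinv f y = Some x \<longleftrightarrow> f x = Some y"
proof -
  have inj: "inj_on f (dom f)"
    using assms by (simp add: sym_inv_monoid_def)
  have uniq: "x' = x''" if "f x' = Some y" "f x'' = Some y" for x' x''
    using inj_onD[OF inj, of x' x''] that by auto
  have "(THE x. f x = Some y) = x'" if "f x' = Some y" for x'
    using that uniq by blast
  then show ?thesis
    unfolding pinv_def ran_def by auto
qed

end

theory Submission
  imports Defs
begin

text \<open>
  Write \<open>P\<close> for a set \<open>P_set X \<Gamma> \<mu>\<close>, \<open>f\<inverse>\<close> for \<open>pinv f\<close>, \<open>P\<inverse>\<close> for \<open>pinv ` P\<close>, and \<open>c(f)\<close> and \<open>d(f)\<close> for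
  collapse and defect.  Call an element of the monoid total if it is defined on all of \<open>X\<close>.

  \<open>P\<close> is a semigroup (\<open>subsemigroup_P_set\<close>).  Elements of small rank form an ideal, and the
  conditions \<open>c(f) \<ge> \<mu>\<close> and \<open>\<Gamma> \<not>\<subseteq> dom f\<close> pass from \<open>f\<close> to every product \<open>f \<cdot> g\<close>.  If instead \<open>f\<close> maps \<open>\<Gamma>\<close>
  onto itself and has defect below \<open>\<mu>\<close>, then nearly all points and all points of \<open>\<Gamma>\<close> are hit by
  \<open>f\<close>, so \<open>f \<cdot> g\<close> inherits whichever of the three conditions \<open>g\<close> satisfies.

  \<open>P\<close> is maximal.  An element outside \<open>P\<close> has collapse below \<open>\<mu>\<close> and rank \<open>|X|\<close>, is defined on \<open>\<Gamma>\<close>, and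
  either moves \<open>\<Gamma>\<close> or has defect at least \<open>\<mu>\<close>.  Together with elements of \<open>P \<inter> P\<inverse>\<close> it generates a
  total \<open>e\<close> whose range misses a point of \<open>\<Gamma>\<close> (\<open>exists_total_missing_point\<close>).  Every \<open>h\<close> is then
  \<open>e \<cdot> (e\<inverse> \<cdot> h)\<close>, and the second factor lies in \<open>P\<close> because it is undefined at that point.  In an
  inverse semigroup one writes \<open>h = e \<cdot> (e\<inverse> \<cdot> h \<cdot> e) \<cdot> e\<inverse>\<close> instead; the middle factor has neither all
  of \<open>\<Gamma>\<close> in its domain nor all of it in its range, hence lies in \<open>P \<inter> P\<inverse>\<close>.

  There is nothing else (\<open>maximal_subset_P_set\<close>).  Let \<open>M\<close> be maximal, of either kind, and contain
  the pointwise stabiliser of \<open>\<Sigma>\<close> but not the symmetric group.  Then \<open>M\<close> lies in no proper subsemigroup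
  containing the symmetric group (\<open>maximal_not_subset\<close>).  Two kinds of such semigroups are used: the
  elements that are permutations if they are total, and the members \<open>P_set X {} \<mu>\<close> with \<open>\<mu> \<le> |X|\<close> of
  the same family.  Suppose that \<open>M\<close> is contained in no \<open>P_set X \<Gamma> \<mu>\<close> with \<open>\<Gamma> \<noteq> {}\<close> either.  Choose a
  total element of \<open>M\<close> whose range meets \<open>\<Sigma>\<close> in a set \<open>\<Gamma>\<close> that is as small as possible.  All total
  elements of \<open>M\<close> map this \<open>\<Gamma>\<close> onto itself (\<open>exists_minimal_trace\<close>).  Let \<open>\<mu>\<close> be the least infinite
  cardinal above their defects.  If some \<open>f\<close> in \<open>M\<close> were outside \<open>P_set X \<Gamma> \<mu>\<close>, a total \<open>h\<close> of large
  defect could be moved into the domain of \<open>f\<close> by some \<open>s\<close> in the stabiliser, and the total element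
  \<open>h \<cdot> s \<cdot> f\<close> would move \<open>\<Gamma>\<close> or have defect at least \<open>\<mu>\<close>, which is impossible.  So \<open>M\<close> is contained
  in \<open>P_set X \<Gamma> \<mu>\<close>, and this leaves only \<open>\<Gamma> = {}\<close> and \<open>\<mu> > |X|\<close>.  Hence \<open>M\<close> contains a total \<open>u\<close> whose
  range avoids \<open>\<Sigma>\<close> and has a complement of size \<open>|X|\<close> (\<open>exists_spreading_element\<close>).  If \<open>M\<close> is also
  contained in no \<open>P\<inverse>\<close>, the same argument gives \<open>v\<close> of this shape with \<open>v\<inverse>\<close> in \<open>M\<close>.  Every permutation
  is \<open>u \<cdot> s \<cdot> v\<inverse>\<close> for some \<open>s\<close> in the stabiliser (\<open>sym_group_subset\<close>), a contradiction.
\<close>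

section \<open>Partial bijections\<close>

lemma pcomp_eq_Some_iff: "(f \<cdot> g) x = Some z \<longleftrightarrow> (\<exists>y. f x = Some y \<and> g y = Some z)"
  by (simp add: pcomp_def map_comp_Some_iff)

lemma mem_sym_inv_monoid_iff:
  "f \<in> sym_inv_monoid X \<longleftrightarrow>
     (\<forall>x y. f x = Some y \<longrightarrow> x \<in> X \<and> y \<in> X) \<and>
     (\<forall>x x' y. f x = Some y \<longrightarrow> f x' = Some y \<longrightarrow> x = x')"
  unfolding sym_inv_monoid_def inj_on_def dom_def ran_def by auto

lemma sym_inv_monoidD:
  assumes "f \<in> sym_inv_monoid X" "f x = Some y"
  shows "x \<in> X" "y \<in> X" "f x' = Some y \<Longrightarrow> x' = x"
  using assms by (auto simp: mem_sym_inv_monoid_iff)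

lemma pcomp_closed:
  assumes "f \<in> sym_inv_monoid X" "g \<in> sym_inv_monoid X"
  shows "f \<cdot> g \<in> sym_inv_monoid X"
  using assms unfolding mem_sym_inv_monoid_iff pcomp_eq_Some_iff by blast

lemma pinv_closed: "f \<in> sym_inv_monoid X \<Longrightarrow> pinv f \<in> sym_inv_monoid X"
  using pinv_eq_Some_iff[of f X] by (simp add: mem_sym_inv_monoid_iff)

lemma map_eqI_Some: "(\<And>x y. f x = Some y \<longleftrightarrow> g x = Some y) \<Longrightarrow> f = g"
  by (rule ext) (metis option.exhaust)

lemma pinv_pinv: "f \<in> sym_inv_monoid X \<Longrightarrow> pinv (pinv f) = f"
  by (rule map_eqI_Some) (simp add: pinv_closed pinv_eq_Some_iff[where X = X])

lemma pinv_pcomp: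
  assumes "f \<in> sym_inv_monoid X" "g \<in> sym_inv_monoid X"
  shows "pinv (f \<cdot> g) = pinv g \<cdot> pinv f"
proof (rule map_eqI_Some)
  fix x y
  show "pinv (f \<cdot> g) x = Some y \<longleftrightarrow> (pinv g \<cdot> pinv f) x = Some y"
    unfolding pinv_eq_Some_iff[OF pcomp_closed[OF assms]] pcomp_eq_Some_iff
      pinv_eq_Some_iff[OF assms(1)] pinv_eq_Some_iff[OF assms(2)] by blast
qed

lemma dom_pinv: "dom (pinv f) = ran f"
  by (auto simp: pinv_def dom_def)

lemma ran_pinv: "f \<in> sym_inv_monoid X \<Longrightarrow> ran (pinv f) = dom f"
  by (auto simp: ran_def dom_def pinv_eq_Some_iff)

lemma pinv_image_iff:
  assumes M: "M \<subseteq> sym_inv_monoid X" and f: "f \<in> sym_inv_monoid X"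
  shows "f \<in> pinv ` M \<longleftrightarrow> pinv f \<in> M"
proof
  assume "f \<in> pinv ` M"
  then obtain g where g: "g \<in> M" "f = pinv g" by blast
  then have "pinv f = g" using pinv_pinv M by blast
  then show "pinv f \<in> M" using g by simp
next
  assume "pinv f \<in> M"
  then have "pinv (pinv f) \<in> pinv ` M" by (rule imageI)
  then show "f \<in> pinv ` M" using pinv_pinv[OF f] by simp
qed

lemma pinv_image_pinv_image:
  assumes "M \<subseteq> sym_inv_monoid X"
  shows "pinv ` pinv ` M = M"
proof -
  have "pinv (pinv f) = id f" if "f \<in> M" for f using that assms pinv_pinv by fastforce
  then show ?thesis by (simp add: image_image)
qed

lemma pinv_image_eqI:
  assumes "M \<subseteq> sym_inv_monoid X" and "\<And>f. f \<in> M \<Longrightarrow> pinv f \<in> M"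
  shows "pinv ` M = M"
proof
  show le: "pinv ` M \<subseteq> M" using assms(2) by blast
  show "M \<subseteq> pinv ` M"
    using image_mono[OF le, of pinv] pinv_image_pinv_image[OF assms(1)] by simp
qed

lemma pinv_image_sym_inv_monoid: "pinv ` sym_inv_monoid X = sym_inv_monoid X"
  by (rule pinv_image_eqI) (auto intro: pinv_closed)

lemma dom_pcomp_subset: "dom (f \<cdot> g) \<subseteq> dom f"
  by (auto simp: dom_def pcomp_eq_Some_iff)

lemma ran_pcomp_subset: "ran (f \<cdot> g) \<subseteq> ran g"
  by (auto simp: ran_def pcomp_eq_Some_iff)

lemma dom_pcomp_total: "ran f \<subseteq> dom g \<Longrightarrow> dom (f \<cdot> g) = dom f"
  by (fastforce simp: dom_def ran_def pcomp_eq_Some_iff)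

lemma mem_pimage_iff: "y \<in> pimage f A \<longleftrightarrow> (\<exists>x\<in>A. f x = Some y)"
  by (force simp: pimage_def dom_def)

lemma ran_pcomp: "ran (f \<cdot> g) = pimage g (ran f)"
  by (rule set_eqI) (simp add: ran_def pcomp_eq_Some_iff mem_pimage_iff, blast)

lemma pimage_pcomp: "pimage (f \<cdot> g) A = pimage g (pimage f A)"
proof (rule set_eqI)
  fix z
  show "z \<in> pimage (f \<cdot> g) A \<longleftrightarrow> z \<in> pimage g (pimage f A)"
    unfolding mem_pimage_iff[of z] pcomp_eq_Some_iff using mem_pimage_iff[of _ f A] by meson
qed

lemma pimage_eq_image: "pimage f A = (\<lambda>x. the (f x)) ` (A \<inter> dom f)"
  by (auto simp: pimage_def)

lemma inj_on_the:
  assumes "f \<in> sym_inv_monoid X" shows "inj_on (\<lambda>x. the (f x)) (A \<inter> dom f)"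
proof (rule inj_onI)
  fix x x' assume "x \<in> A \<inter> dom f" "x' \<in> A \<inter> dom f" and eq: "the (f x) = the (f x')"
  then obtain y y' where "f x = Some y" "f x' = Some y'" by blast
  then show "x = x'" using sym_inv_monoidD(3)[OF assms] eq by simp
qed

lemma card_pimage_ordLeq: "|pimage f A| \<le>o |A|"
  unfolding pimage_eq_image by (meson card_of_image card_of_mono1 inf_le1 ordLeq_transitive)

lemma card_pimage_ordIso:
  assumes "f \<in> sym_inv_monoid X" "A \<subseteq> dom f" shows "|A| =o |pimage f A|"
  using inj_on_the[OF assms(1), of A] assms(2)
  by (auto simp: pimage_eq_image Int_absorb2 intro!: card_of_ordIsoI inj_on_imp_bij_betw)

lemma pimage_dom: "pimage f (dom f) = ran f"
  by (force simp: mem_pimage_iff ran_def)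

lemma card_dom_ordIso_ran:
  assumes "f \<in> sym_inv_monoid X" shows "|dom f| =o |ran f|"
  using card_pimage_ordIso[OF assms, of "dom f"] by (simp add: pimage_dom)

lemma finite_subset_pimage_imp_eq:
  assumes "finite \<Gamma>" "\<Gamma> \<subseteq> pimage f \<Gamma>"
  shows "pimage f \<Gamma> = \<Gamma>"
proof -
  have "card (pimage f \<Gamma>) \<le> card \<Gamma>"
    unfolding pimage_eq_image using assms(1) by (meson card_image_le card_mono finite_Int inf_le1 le_trans)
  moreover have "finite (pimage f \<Gamma>)" using assms(1) by (simp add: pimage_eq_image)
  ultimately have "\<Gamma> = pimage f \<Gamma>" using assms(2) by (intro card_seteq)
  then show ?thesis by simp
qed

text \<open>
  By finiteness, \<open>f\<close> can map only all of \<open>\<Gamma>\<close> onto \<open>\<Gamma>\<close>, so the condition \<open>pimage f \<Gamma> = \<Gamma>\<close> forces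
  \<open>\<Gamma>\<close> into domain and range and is invariant under inversion.
\<close>

lemma finite_pimage_eqD:
  assumes f: "f \<in> sym_inv_monoid X" and "finite \<Gamma>" and eq: "pimage f \<Gamma> = \<Gamma>"
  shows "\<Gamma> \<subseteq> dom f" "\<Gamma> \<subseteq> ran f" "pimage (pinv f) \<Gamma> = \<Gamma>"
proof -
  have "card \<Gamma> = card (\<Gamma> \<inter> dom f)"
    using eq card_image[OF inj_on_the[OF f], of \<Gamma>] by (simp add: pimage_eq_image)
  then show sub: "\<Gamma> \<subseteq> dom f"
    using assms(2) by (metis card_subset_eq inf.absorb_iff1 inf_le1)
  show "\<Gamma> \<subseteq> ran f" using eq mem_pimage_iff[of _ f \<Gamma>] by (auto intro: ranI)
  show "pimage (pinv f) \<Gamma> = \<Gamma>"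
  proof (intro set_eqI iffI)
    fix x assume "x \<in> pimage (pinv f) \<Gamma>"
    then obtain y where y: "y \<in> \<Gamma>" "f x = Some y" using f by (auto simp: mem_pimage_iff pinv_eq_Some_iff)
    then obtain x' where "x' \<in> \<Gamma>" "f x' = Some y" using eq by (metis mem_pimage_iff)
    then show "x \<in> \<Gamma>" using sym_inv_monoidD(3)[OF f y(2)] by blast
  next
    fix x assume x: "x \<in> \<Gamma>"
    then obtain y where y: "f x = Some y" using sub by auto
    then have "y \<in> \<Gamma>" using eq x by (metis mem_pimage_iff)
    then show "x \<in> pimage (pinv f) \<Gamma>" using y f by (auto simp: mem_pimage_iff pinv_eq_Some_iff)
  qed
qed

text \<open>
  For total \<open>f\<close> the product \<open>f \<cdot> pinv f\<close> is the identity.  This is what allows every \<open>h\<close> to be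
  factored through a total element.
\<close>

lemma pcomp_pinv_pcomp:
  assumes f: "f \<in> sym_inv_monoid X" and tot: "dom f = X" and h: "h \<in> sym_inv_monoid X"
  shows "f \<cdot> (pinv f \<cdot> h) = h"
proof (rule map_eqI_Some)
  fix x y
  show "(f \<cdot> (pinv f \<cdot> h)) x = Some y \<longleftrightarrow> h x = Some y"
  proof
    assume "(f \<cdot> (pinv f \<cdot> h)) x = Some y"
    then obtain z x' where "f x = Some z" "f x' = Some z" "h x' = Some y"
      using f by (auto simp: pcomp_eq_Some_iff pinv_eq_Some_iff)
    then show "h x = Some y" using sym_inv_monoidD(3)[OF f] by blast
  next
    assume hx: "h x = Some y"
    then obtain z where "f x = Some z" using sym_inv_monoidD(1)[OF h] tot by blast
    then show "(f \<cdot> (pinv f \<cdot> h)) x = Some y"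
      using hx f by (auto simp: pcomp_eq_Some_iff pinv_eq_Some_iff)
  qed
qed

section \<open>Inversion of subsemigroups\<close>

lemma subsemigroupD:
  assumes "subsemigroup X M"
  shows "M \<subseteq> sym_inv_monoid X" "\<lbrakk>f \<in> M; g \<in> M\<rbrakk> \<Longrightarrow> f \<cdot> g \<in> M"
  using assms by (auto simp: subsemigroup_def)

lemma subsemigroup_pinv_image:
  assumes "subsemigroup X M" shows "subsemigroup X (pinv ` M)"
  unfolding subsemigroup_def
proof (intro conjI ballI)
  note sub = subsemigroupD(1)[OF assms]
  show "pinv ` M \<subseteq> sym_inv_monoid X" using sub pinv_closed by blast
  fix f g assume "f \<in> pinv ` M" "g \<in> pinv ` M"
  then obtain f' g' where "f' \<in> M" "g' \<in> M" "f = pinv f'" "g = pinv g'" by blast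
  moreover from this have "f \<cdot> g = pinv (g' \<cdot> f')"
    using sub pinv_pcomp[of g' X f'] by (simp add: subset_iff)
  ultimately show "f \<cdot> g \<in> pinv ` M"
    using subsemigroupD(2)[OF assms] by blast
qed

lemma inverse_subsemigroup_Int_pinv_image:
  assumes "subsemigroup X M" shows "inverse_subsemigroup X (M \<inter> pinv ` M)"
proof -
  have "subsemigroup X (M \<inter> pinv ` M)"
    using assms subsemigroup_pinv_image[OF assms] unfolding subsemigroup_def by blast
  moreover have "pinv f \<in> M \<inter> pinv ` M" if f: "f \<in> M \<inter> pinv ` M" for f
  proof
    have "f \<in> sym_inv_monoid X" using f subsemigroupD(1)[OF assms] by blast
    then show "pinv f \<in> M" using f pinv_image_iff[OF subsemigroupD(1)[OF assms]] by blast
    show "pinv f \<in> pinv ` M" using f by blast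
  qed
  ultimately show ?thesis unfolding inverse_subsemigroup_def by blast
qed

lemma inverse_subsemigroup_pinv_image:
  assumes "inverse_subsemigroup X M" shows "pinv ` M = M"
  using assms by (intro pinv_image_eqI) (auto simp: inverse_subsemigroup_def subsemigroup_def)

lemma pinv_image_neq_sym_inv_monoid:
  assumes "M \<subseteq> sym_inv_monoid X" "M \<noteq> sym_inv_monoid X"
  shows "pinv ` M \<noteq> sym_inv_monoid X"
proof
  assume "pinv ` M = sym_inv_monoid X"
  then have "pinv ` pinv ` M = pinv ` sym_inv_monoid X" by simp
  then show False using assms(2) pinv_image_pinv_image[OF assms(1)] pinv_image_sym_inv_monoid[of X] by simp
qed

lemma maximal_subsemigroup_pinv_image:
  assumes "maximal_subsemigroup X M" shows "maximal_subsemigroup X (pinv ` M)"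
proof -
  have M: "subsemigroup X M" "M \<noteq> sym_inv_monoid X"
    and max: "\<And>N. \<lbrakk>subsemigroup X N; N \<noteq> sym_inv_monoid X; M \<subseteq> N\<rbrakk> \<Longrightarrow> N = M"
    using assms unfolding maximal_subsemigroup_def maximal_element_def by auto
  have "N = pinv ` M"
    if N: "subsemigroup X N" "N \<noteq> sym_inv_monoid X" "pinv ` M \<subseteq> N" for N
  proof -
    have sub: "N \<subseteq> sym_inv_monoid X" "M \<subseteq> sym_inv_monoid X"
      using subsemigroupD(1) N(1) M(1) by auto
    have "pinv ` N \<noteq> sym_inv_monoid X"
      using pinv_image_neq_sym_inv_monoid[OF sub(1) N(2)] .
    moreover have "M \<subseteq> pinv ` N"
      using image_mono[OF N(3), of pinv] pinv_image_pinv_image[OF sub(2)] by simp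
    ultimately have "pinv ` N = M"
      using max[of "pinv ` N"] subsemigroup_pinv_image[OF N(1)] by blast
    then show ?thesis using pinv_image_pinv_image[OF sub(1)] by blast
  qed
  moreover have "pinv ` M \<noteq> sym_inv_monoid X"
    using pinv_image_neq_sym_inv_monoid[OF subsemigroupD(1)[OF M(1)] M(2)] .
  ultimately show ?thesis
    using subsemigroup_pinv_image[OF M(1)] unfolding maximal_subsemigroup_def maximal_element_def by auto
qed

lemma pinv_image_sym_group: "pinv ` sym_group X = sym_group X"
  by (rule pinv_image_eqI[where X = X])
    (simp_all add: sym_group_def pinv_closed dom_pinv ran_pinv[where X = X] subset_iff)

lemma pinv_image_pointwise_stabiliser:
  "pinv ` pointwise_stabiliser X \<Sigma> = pointwise_stabiliser X \<Sigma>"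
proof (rule pinv_image_eqI)
  show "pointwise_stabiliser X \<Sigma> \<subseteq> sym_inv_monoid X"
    by (auto simp: pointwise_stabiliser_def sym_group_def)
  fix f assume f: "f \<in> pointwise_stabiliser X \<Sigma>"
  then have "f \<in> sym_inv_monoid X" "f \<in> sym_group X"
    by (simp_all add: pointwise_stabiliser_def sym_group_def)
  moreover from this have "pinv f \<in> sym_group X" using pinv_image_sym_group[of X] by blast
  ultimately show "pinv f \<in> pointwise_stabiliser X \<Sigma>"
    using f pinv_eq_Some_iff[of f X] by (simp add: pointwise_stabiliser_def)
qed

section \<open>Collapse, defect and the semigroups of the classification\<close>

lemma collapse_pinv: "collapse X (pinv f) = defect X f"
  by (simp add: collapse_def defect_def dom_pinv)

lemma defect_pinv: "f \<in> sym_inv_monoid X \<Longrightarrow> defect X (pinv f) = collapse X f"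
  by (simp add: collapse_def defect_def ran_pinv)

lemma card_not_ordLeq_iff:
  "Card_order \<mu> \<Longrightarrow> \<not> \<mu> \<le>o |A| \<longleftrightarrow> |A| <o \<mu>"
  using not_ordLeq_iff_ordLess[of "|A|" \<mu>] card_of_Well_order by (auto simp: card_order_on_def)

text \<open>
  Below an infinite cardinal, unions of two sets stay below; all estimates of collapse and defect
  come down to this.
\<close>

lemma Un_ordLess:
  "\<lbrakk>Card_order \<mu>; cinfinite \<mu>; |A| <o \<mu>; |B| <o \<mu>; C \<subseteq> A \<union> B\<rbrakk> \<Longrightarrow> |C| <o \<mu>"
  using card_of_Un_ordLess_infinite_Field[of \<mu> A B] card_of_mono1[of C "A \<union> B"]
  by (auto simp: cinfinite_def intro: ordLeq_ordLess_trans)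

lemma collapse_pcomp_ge: "collapse X f \<le>o collapse X (f \<cdot> g)"
  unfolding collapse_def using dom_pcomp_subset[of f g] by (intro card_of_mono1) auto

lemma defect_pcomp_ge: "defect X g \<le>o defect X (f \<cdot> g)"
  unfolding defect_def using ran_pcomp_subset[of f g] by (intro card_of_mono1) auto

text \<open>
  A point outside the range of \<open>f \<cdot> g\<close> is either outside the range of \<open>g\<close> or the image under \<open>g\<close> of a
  point that \<open>f\<close> misses.
\<close>

lemma defect_pcomp_less:
  assumes \<mu>: "Card_order \<mu>" "cinfinite \<mu>" and g: "g \<in> sym_inv_monoid X"
    and "defect X f <o \<mu>" "defect X g <o \<mu>"
  shows "defect X (f \<cdot> g) <o \<mu>"
proof -
  have "|pimage g (X - ran f)| <o \<mu>"
    using assms(4) card_pimage_ordLeq unfolding defect_def by (blast intro: ordLeq_ordLess_trans)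
  moreover have "X - ran (f \<cdot> g) \<subseteq> (X - ran g) \<union> pimage g (X - ran f)"
  proof
    fix z assume z: "z \<in> X - ran (f \<cdot> g)"
    show "z \<in> (X - ran g) \<union> pimage g (X - ran f)"
    proof (cases "z \<in> ran g")
      case True
      then obtain y where y: "g y = Some z" by (auto simp: ran_def)
      then have "y \<in> X - ran f"
        using z sym_inv_monoidD(1)[OF g y] by (auto simp: ran_pcomp mem_pimage_iff)
      then show ?thesis using y by (auto simp: mem_pimage_iff)
    qed (use z in auto)
  qed
  ultimately show ?thesis
    using Un_ordLess[OF \<mu> assms(5)[unfolded defect_def]] unfolding defect_def by blast
qed

text \<open>
  A point where \<open>g\<close> is undefined is either missed by \<open>f\<close> or the image of a point where \<open>f \<cdot> g\<close> is
  undefined.  So when \<open>f\<close> has defect below \<open>\<mu>\<close>, large collapse of \<open>g\<close> makes that of \<open>f \<cdot> g\<close> large.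
\<close>

lemma collapse_right_less:
  assumes \<mu>: "Card_order \<mu>" "cinfinite \<mu>" and f: "f \<in> sym_inv_monoid X"
    and "defect X f <o \<mu>" "collapse X (f \<cdot> g) <o \<mu>"
  shows "collapse X g <o \<mu>"
proof -
  have "|pimage f (X - dom (f \<cdot> g))| <o \<mu>"
    using assms(5) card_pimage_ordLeq unfolding collapse_def by (blast intro: ordLeq_ordLess_trans)
  moreover have "X - dom g \<subseteq> (X - ran f) \<union> pimage f (X - dom (f \<cdot> g))"
  proof
    fix y assume y: "y \<in> X - dom g"
    show "y \<in> (X - ran f) \<union> pimage f (X - dom (f \<cdot> g))"
    proof (cases "y \<in> ran f")
      case True
      then obtain x where x: "f x = Some y" by (auto simp: ran_def)
      then have "x \<in> X - dom (f \<cdot> g)"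
        using y sym_inv_monoidD(1)[OF f x] by (auto simp: pcomp_eq_Some_iff)
      then show ?thesis using x by (auto simp: mem_pimage_iff)
    qed (use y in auto)
  qed
  ultimately show ?thesis
    using Un_ordLess[OF \<mu> assms(4)[unfolded defect_def]] unfolding collapse_def by blast
qed

lemma mem_small_rank_iff: "f \<in> small_rank X \<longleftrightarrow> f \<in> sym_inv_monoid X \<and> |ran f| <o |X|"
  by (simp add: small_rank_def rank_def)

lemma small_rank_pcomp:
  assumes f: "f \<in> sym_inv_monoid X" and g: "g \<in> sym_inv_monoid X"
    and "f \<in> small_rank X \<or> g \<in> small_rank X"
  shows "f \<cdot> g \<in> small_rank X"
proof -
  have "|ran (f \<cdot> g)| \<le>o |ran f|" unfolding ran_pcomp by (rule card_pimage_ordLeq)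
  moreover have "|ran (f \<cdot> g)| \<le>o |ran g|" by (intro card_of_mono1 ran_pcomp_subset)
  ultimately show ?thesis
    using assms pcomp_closed[OF f g] by (auto simp: mem_small_rank_iff intro: ordLeq_ordLess_trans)
qed

lemma pinv_small_rank_iff: 
  assumes f: "f \<in> sym_inv_monoid X" shows "pinv f \<in> small_rank X \<longleftrightarrow> f \<in> small_rank X"
  using card_dom_ordIso_ran[OF f] f
  by (auto simp: mem_small_rank_iff pinv_closed ran_pinv dest: ordIso_symmetric intro: ordIso_ordLess_trans)

lemma not_small_rank_dom:
  assumes f: "f \<in> sym_inv_monoid X" and "f \<notin> small_rank X" shows "|dom f| =o |X|"
proof -
  have "|dom f| \<le>o |X|" using f by (intro card_of_mono1) (auto simp: sym_inv_monoid_def)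
  moreover have "\<not> |dom f| <o |X|"
    using assms ordIso_ordLess_trans[OF ordIso_symmetric[OF card_dom_ordIso_ran[OF f]]]
    by (auto simp: mem_small_rank_iff)
  ultimately show ?thesis by (simp add: ordLeq_iff_ordLess_or_ordIso)
qed

lemma mem_P_set_iff:
  "f \<in> P_set X \<Gamma> \<mu> \<longleftrightarrow> f \<in> sym_inv_monoid X \<and>
     (\<mu> \<le>o collapse X f \<or> \<not> \<Gamma> \<subseteq> dom f \<or> (pimage f \<Gamma> = \<Gamma> \<and> defect X f <o \<mu>) \<or> f \<in> small_rank X)"
  by (auto simp: P_set_def small_rank_def)

text \<open>
  The set \<open>\<Gamma>\<close> is arbitrary here: \<open>\<Gamma> = {}\<close> gives the elements with \<open>c(f) \<ge> \<mu>\<close> or \<open>d(f) < \<mu>\<close> or small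
  rank, one of the semigroups containing the symmetric group that the classification needs.
\<close>

lemma subsemigroup_P_set:
  assumes \<mu>: "Card_order \<mu>" "cinfinite \<mu>" shows "subsemigroup X (P_set X \<Gamma> \<mu>)"
  unfolding subsemigroup_def
proof (intro conjI ballI)
  show "P_set X \<Gamma> \<mu> \<subseteq> sym_inv_monoid X" by (auto simp: mem_P_set_iff)
  fix f g assume fg: "f \<in> P_set X \<Gamma> \<mu>" "g \<in> P_set X \<Gamma> \<mu>"
  then have f: "f \<in> sym_inv_monoid X" and g: "g \<in> sym_inv_monoid X" by (auto simp: mem_P_set_iff)
  note I = pcomp_closed[OF f g]
  consider "f \<in> small_rank X \<or> g \<in> small_rank X" | "\<mu> \<le>o collapse X f" | "\<not> \<Gamma> \<subseteq> dom f"
    | (keep) "pimage f \<Gamma> = \<Gamma>" "defect X f <o \<mu>" "g \<notin> small_rank X"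
    using fg by (auto simp: mem_P_set_iff)
  then show "f \<cdot> g \<in> P_set X \<Gamma> \<mu>"
  proof cases
    case 1 then show ?thesis using small_rank_pcomp[OF f g] I by (simp add: mem_P_set_iff)
  next
    case 2 then show ?thesis
      using I ordLeq_transitive[OF _ collapse_pcomp_ge] by (auto simp: mem_P_set_iff)
  next
    case 3
    then have "\<not> \<Gamma> \<subseteq> dom (f \<cdot> g)" using dom_pcomp_subset[of f g] by blast
    then show ?thesis using I by (simp add: mem_P_set_iff)
  next
    case keep
    consider "\<mu> \<le>o collapse X g" | "\<not> \<Gamma> \<subseteq> dom g" | "pimage g \<Gamma> = \<Gamma>" "defect X g <o \<mu>"
      using fg(2) keep(3) by (auto simp: mem_P_set_iff)
    then show ?thesis
    proof cases
      case 1
      then have "\<mu> \<le>o collapse X (f \<cdot> g)"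
        using collapse_right_less[OF \<mu> f keep(2)]
          card_not_ordLeq_iff[OF \<mu>(1), of "X - dom g"]
          card_not_ordLeq_iff[OF \<mu>(1), of "X - dom (f \<cdot> g)"]
        unfolding collapse_def by blast
      then show ?thesis using I by (simp add: mem_P_set_iff)
    next
      case 2
      then obtain y where y: "y \<in> \<Gamma>" "y \<notin> dom g" by auto
      then obtain x where x: "x \<in> \<Gamma>" "f x = Some y" using keep(1) by (metis mem_pimage_iff)
      then have "x \<notin> dom (f \<cdot> g)" using y by (auto simp: pcomp_eq_Some_iff)
      then have "\<not> \<Gamma> \<subseteq> dom (f \<cdot> g)" using x by blast
      then show ?thesis using I by (simp add: mem_P_set_iff)
    next
      case 3
      then show ?thesis
        using I keep defect_pcomp_less[OF \<mu> g] by (simp add: mem_P_set_iff pimage_pcomp)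
    qed
  qed
qed

section \<open>Constructing partial bijections\<close>

lemma finite_ordLess:
  assumes "finite A" "Card_order \<mu>" "cinfinite \<mu>" shows "|A| <o \<mu>"
  using assms finite_ordLess_infinite[OF card_of_Well_order, of \<mu> A]
  by (simp add: cinfinite_def Field_card_of card_order_on_well_order_on)

lemma card_of_diff_finite:
  assumes "infinite A" "finite F" shows "|A - F| =o |A|"
proof -
  have "\<not> |A - F| <o |A|"
  proof
    assume "|A - F| <o |A|"
    moreover have "|F| <o |A|"
      using assms by (intro finite_ordLess) (simp_all add: card_of_card_order_on cinfinite_def Field_card_of)
    ultimately have "|A| <o |A|"
      using assms(1) by (intro Un_ordLess[of "|A|" "A - F" F A]) (auto simp: cinfinite_def Field_card_of card_of_card_order_on)
    then show False by (simp add: ordLess_irreflexive)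
  qed
  moreover have "|A - F| \<le>o |A|" by (intro card_of_mono1) auto
  ultimately show ?thesis by (simp add: ordLeq_iff_ordLess_or_ordIso)
qed

lemma partial_bijection_of_bij_betw:
  assumes "bij_betw b A B" "A \<subseteq> X" "B \<subseteq> X"
  defines "f \<equiv> \<lambda>x. if x \<in> A then Some (b x) else None"
  shows "f \<in> sym_inv_monoid X" "dom f = A" "ran f = B"
proof -
  show dom: "dom f = A" by (auto simp: f_def dom_def)
  show ran: "ran f = B" using assms(1) by (auto simp: f_def ran_def bij_betw_def)
  have "inj_on f (dom f)"
    using assms(1) unfolding dom by (auto simp: f_def bij_betw_def inj_on_def)
  then show "f \<in> sym_inv_monoid X" using dom ran assms(2,3) by (simp add: sym_inv_monoid_def)
qed

text \<open>
  Since \<open>\<Gamma>\<close> is finite, its complements in \<open>X\<close> and in \<open>B\<close> still have the same cardinality, and any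
  bijection between them extends by the identity on \<open>\<Gamma>\<close>.
\<close>

lemma exists_total_onto:
  assumes "infinite X" "finite \<Gamma>" "\<Gamma> \<subseteq> B" "B \<subseteq> X" "|B| =o |X|"
  shows "\<exists>g \<in> sym_inv_monoid X. dom g = X \<and> ran g = B \<and> (\<forall>x\<in>\<Gamma>. g x = Some x)"
proof -
  have "infinite B" using assms(1,5) card_of_ordIso_finite by blast
  then have "|X - \<Gamma>| =o |B - \<Gamma>|"
    using assms card_of_diff_finite ordIso_symmetric ordIso_transitive by metis
  then obtain b where b: "bij_betw b (X - \<Gamma>) (B - \<Gamma>)" using card_of_ordIso by blast
  have "bij_betw (\<lambda>x. if x \<in> \<Gamma> then x else b x) X B"
  proof -
    have "bij_betw (\<lambda>x. if x \<in> \<Gamma> then x else b x) (\<Gamma> \<union> (X - \<Gamma>)) (\<Gamma> \<union> (B - \<Gamma>))"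
      using b by (intro bij_betw_disjoint_Un) (auto simp: bij_betw_def inj_on_def)
    moreover have "\<Gamma> \<union> (X - \<Gamma>) = X" "\<Gamma> \<union> (B - \<Gamma>) = B" using assms by auto
    ultimately show ?thesis by simp
  qed
  from partial_bijection_of_bij_betw[OF this subset_refl assms(4)] show ?thesis
    using assms(3,4) by (intro bexI[where x = "\<lambda>x. if x \<in> X then Some (if x \<in> \<Gamma> then x else b x) else None"]) auto
qed

text \<open>
  The extension is the identity on \<open>\<Sigma>\<close>, agrees with \<open>q\<close> on its domain, and is an arbitrary bijection
  between the remaining points.  With \<open>\<Sigma> = {}\<close> this extends \<open>q\<close> to a permutation of \<open>X\<close>.
\<close>

lemma exists_stabiliser_extension:
  assumes q: "q \<in> sym_inv_monoid X" and "dom q \<inter> \<Sigma> = {}" "ran q \<inter> \<Sigma> = {}" "\<Sigma> \<subseteq> X"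
    and "|X - \<Sigma> - dom q| =o |X - \<Sigma> - ran q|"
  shows "\<exists>s \<in> pointwise_stabiliser X \<Sigma>. q \<subseteq>\<^sub>m s"
proof -
  obtain b where b: "bij_betw b (X - \<Sigma> - dom q) (X - \<Sigma> - ran q)" using assms(5) card_of_ordIso by blast
  have dq: "dom q \<subseteq> X" and rq: "ran q \<subseteq> X" using q by (auto simp: sym_inv_monoid_def)
  have qb: "bij_betw (\<lambda>x. the (q x)) (dom q) (ran q)"
    using inj_on_the[OF q, of "dom q"] by (force simp: bij_betw_def ran_def)
  let ?m = "\<lambda>x. if x \<in> dom q then the (q x) else if x \<in> \<Sigma> then x else b x"
  have "bij_betw ?m (\<Sigma> \<union> (X - \<Sigma> - dom q)) (\<Sigma> \<union> (X - \<Sigma> - ran q))"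
  proof (rule bij_betw_combine)
    show "bij_betw ?m \<Sigma> \<Sigma>" using assms(2) by (auto simp: bij_betw_def inj_on_def)
    show "bij_betw ?m (X - \<Sigma> - dom q) (X - \<Sigma> - ran q)"
      using b by (rule bij_betw_cong[THEN iffD1, rotated]) auto
  qed auto
  moreover have "bij_betw ?m (dom q) (ran q)"
    using qb by (rule bij_betw_cong[THEN iffD1, rotated]) auto
  ultimately have "bij_betw ?m (dom q \<union> (\<Sigma> \<union> (X - \<Sigma> - dom q))) (ran q \<union> (\<Sigma> \<union> (X - \<Sigma> - ran q)))"
    using bij_betw_combine[of ?m "dom q" "ran q" "\<Sigma> \<union> (X - \<Sigma> - dom q)" "\<Sigma> \<union> (X - \<Sigma> - ran q)"]
      assms(3) by blast
  moreover have "dom q \<union> (\<Sigma> \<union> (X - \<Sigma> - dom q)) = X" "ran q \<union> (\<Sigma> \<union> (X - \<Sigma> - ran q)) = X"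
    using dq rq assms(4) by auto
  ultimately have m: "bij_betw ?m X X" by simp
  let ?s = "\<lambda>x. if x \<in> X then Some (?m x) else None"
  note s = partial_bijection_of_bij_betw[OF m subset_refl subset_refl]
  have "?s x = Some x" if "x \<in> \<Sigma>" for x
  proof -
    have "x \<in> X" "x \<notin> dom q" using that assms(2,4) by auto
    then show ?thesis using that by simp
  qed
  moreover have "q \<subseteq>\<^sub>m ?s"
  proof (simp only: map_le_def, rule ballI)
    fix x assume x: "x \<in> dom q"
    then have "x \<in> X" using dq by auto
    then show "q x = ?s x" using x by auto
  qed
  ultimately show ?thesis using s unfolding pointwise_stabiliser_def sym_group_def by blast
qed

section \<open>Maximality\<close>

text \<open>
  Inversion exchanges domain with range and collapse with defect.
\<close>

lemma mem_pinv_image_P_set_iff: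
  assumes "finite \<Gamma>"
  shows "f \<in> pinv ` P_set X \<Gamma> \<mu> \<longleftrightarrow> f \<in> sym_inv_monoid X \<and>
     (\<mu> \<le>o defect X f \<or> \<not> \<Gamma> \<subseteq> ran f \<or> (pimage f \<Gamma> = \<Gamma> \<and> collapse X f <o \<mu>) \<or> f \<in> small_rank X)"
proof (cases "f \<in> sym_inv_monoid X")
  case True
  have "pimage (pinv f) \<Gamma> = \<Gamma> \<longleftrightarrow> pimage f \<Gamma> = \<Gamma>"
    using finite_pimage_eqD(3)[OF True assms] finite_pimage_eqD(3)[OF pinv_closed[OF True] assms]
    unfolding pinv_pinv[OF True] by blast
  moreover have "P_set X \<Gamma> \<mu> \<subseteq> sym_inv_monoid X" by (auto simp: mem_P_set_iff)
  ultimately show ?thesis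
    using True by (simp add: pinv_image_iff mem_P_set_iff[of "pinv f"] pinv_closed collapse_pinv
        defect_pinv dom_pinv pinv_small_rank_iff)
next
  case False
  moreover have "pinv ` P_set X \<Gamma> \<mu> \<subseteq> sym_inv_monoid X"
    using pinv_closed mem_P_set_iff[of _ X \<Gamma> \<mu>] by blast
  ultimately have "f \<notin> pinv ` P_set X \<Gamma> \<mu>" by blast
  with False show ?thesis by blast
qed

lemma total_pcomp: "\<lbrakk>dom f = X; ran f \<subseteq> dom g\<rbrakk> \<Longrightarrow> dom (f \<cdot> g) = X"
  by (simp add: dom_pcomp_total)

lemma ran_subset_carrier: "f \<in> sym_inv_monoid X \<Longrightarrow> ran f \<subseteq> X"
  by (simp add: sym_inv_monoid_def)

lemma ordLeq_imp_not_ordLess: "\<mu> \<le>o \<nu> \<Longrightarrow> \<not> \<nu> <o \<mu>"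
  using not_ordLess_ordLeq by blast

text \<open>
  An element of \<open>P \<inter> P\<inverse>\<close> that maps \<open>X\<close> onto the domain of \<open>f\<close> and fixes \<open>\<Gamma>\<close> pointwise makes \<open>f\<close> total
  without changing its range or its action on \<open>\<Gamma>\<close>.  If \<open>f\<close> moves \<open>\<Gamma>\<close>, some \<open>\<gamma>\<close> in \<open>\<Gamma>\<close> is either not hit
  or hit only from some \<open>x\<close> outside \<open>\<Gamma>\<close>; in the latter case \<open>x\<close> is removed by multiplying on the left
  with a total element of defect one.  If \<open>f\<close> fixes \<open>\<Gamma>\<close> setwise, its defect is at least \<open>\<mu>\<close>, so that
  every partial bijection with the range of \<open>f\<close> as its domain has collapse at least \<open>\<mu>\<close>; one whose
  range misses a point of \<open>\<Gamma>\<close> therefore lies in \<open>P \<inter> P\<inverse>\<close> and can be multiplied on the right.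
\<close>

lemma exists_total_missing_point:
  assumes X: "infinite X" and \<Gamma>: "finite \<Gamma>" "\<Gamma> \<subseteq> X" "\<Gamma> \<noteq> {}"
    and \<mu>: "Card_order \<mu>" "cinfinite \<mu>"
    and N: "subsemigroup X N" and sub: "P_set X \<Gamma> \<mu> \<inter> pinv ` P_set X \<Gamma> \<mu> \<subseteq> N"
    and f: "f \<in> N" "f \<notin> P_set X \<Gamma> \<mu>"
  shows "\<exists>f\<^sub>0\<in>N. dom f\<^sub>0 = X \<and> \<not> \<Gamma> \<subseteq> ran f\<^sub>0"
proof -
  note QI = sub[THEN subsetD, OF IntI, OF mem_P_set_iff[THEN iffD2] mem_pinv_image_P_set_iff[OF \<Gamma>(1), THEN iffD2]]
  have fI: "f \<in> sym_inv_monoid X" using f(1) subsemigroupD(1)[OF N] by blast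
  have f_small: "|X - dom f| <o \<mu>" and dom: "\<Gamma> \<subseteq> dom f" and rank: "f \<notin> small_rank X"
    and bad: "pimage f \<Gamma> \<noteq> \<Gamma> \<or> \<not> defect X f <o \<mu>"
    using f(2) fI card_not_ordLeq_iff[OF \<mu>(1), of "X - dom f"] by (auto simp: mem_P_set_iff collapse_def)
  \<comment> \<open>The elements of \<open>P \<inter> P\<inverse>\<close> used on the left: total, fixing \<open>\<Gamma>\<close>, of small defect.\<close>
  have fix_in_N: "g \<in> N"
    if "g \<in> sym_inv_monoid X" "dom g = X" "\<forall>x\<in>\<Gamma>. g x = Some x" "|X - ran g| <o \<mu>" for g
  proof -
    have "pimage g \<Gamma> = \<Gamma>" using that(3) by (auto simp: mem_pimage_iff)
    moreover have "collapse X g <o \<mu>" using that(2) finite_ordLess[of "{}"] \<mu> by (simp add: collapse_def)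
    ultimately show ?thesis using QI[of g] that(1,4) by (simp add: defect_def)
  qed
  have "dom f \<subseteq> X" using fI by (simp add: sym_inv_monoid_def)
  then obtain g where g: "g \<in> sym_inv_monoid X" "dom g = X" "ran g = dom f" "\<forall>x\<in>\<Gamma>. g x = Some x"
    using exists_total_onto[OF X \<Gamma>(1) dom _ not_small_rank_dom[OF fI rank]] by blast
  define f' where "f' = g \<cdot> f"
  have "g \<in> N" using fix_in_N[OF g(1,2,4)] f_small g(3) by simp
  then have f'N: "f' \<in> N" using f(1) subsemigroupD(2)[OF N] by (simp add: f'_def)
  have f'dom: "dom f' = X" using total_pcomp[OF g(2)] g(3) by (simp add: f'_def)
  have f'ran: "ran f' = ran f" by (simp add: f'_def ran_pcomp g(3) pimage_dom)
  have f'I: "f' \<in> sym_inv_monoid X" using f'N subsemigroupD(1)[OF N] by blast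
  show ?thesis
  proof (cases "pimage f \<Gamma> = \<Gamma>")
    case False
    then have "\<not> \<Gamma> \<subseteq> pimage f \<Gamma>" using finite_subset_pimage_imp_eq[OF \<Gamma>(1)] by blast
    then obtain \<gamma> where \<gamma>: "\<gamma> \<in> \<Gamma>" "\<gamma> \<notin> pimage f \<Gamma>" by blast
    show ?thesis
    proof (cases "\<gamma> \<in> ran f'")
      case False
      then show ?thesis using f'N f'dom \<gamma>(1) by blast
    next
      case True
      then obtain x where x: "f' x = Some \<gamma>" by (auto simp: ran_def)
      have xX: "x \<in> X" using sym_inv_monoidD(1)[OF f'I x] .
      have "x \<notin> \<Gamma>"
      proof
        assume "x \<in> \<Gamma>"
        then have "f x = Some \<gamma>" using x g(4) by (auto simp: f'_def pcomp_eq_Some_iff)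
        then show False using \<gamma>(2) \<open>x \<in> \<Gamma>\<close> by (auto simp: mem_pimage_iff)
      qed
      then have "\<Gamma> \<subseteq> X - {x}" using \<Gamma>(2) by blast
      from exists_total_onto[OF X \<Gamma>(1) this Diff_subset card_of_diff_finite[OF X]]
      obtain k where k: "k \<in> sym_inv_monoid X" "dom k = X" "ran k = X - {x}" "\<forall>x\<in>\<Gamma>. k x = Some x"
        by blast
      have "X - (X - {x}) = {x}" using xX by blast
      then have "k \<in> N" using fix_in_N[OF k(1,2,4)] k(3) finite_ordLess[of "{x}" \<mu>] \<mu> by simp
      then have "k \<cdot> f' \<in> N" using f'N subsemigroupD(2)[OF N] by blast
      moreover have "dom (k \<cdot> f') = X" using total_pcomp[OF k(2)] k(3) f'dom by blast
      moreover have "\<gamma> \<notin> ran (k \<cdot> f')"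
      proof
        assume "\<gamma> \<in> ran (k \<cdot> f')"
        then obtain y where y: "y \<in> ran k" "f' y = Some \<gamma>" by (auto simp: ran_pcomp mem_pimage_iff)
        then show False using sym_inv_monoidD(3)[OF f'I x] k(3) by blast
      qed
      ultimately show ?thesis using \<gamma>(1) by blast
    qed
  next
    case True
    then have d: "\<mu> \<le>o |X - ran f|"
      using bad card_not_ordLeq_iff[OF \<mu>(1), of "X - ran f"] by (auto simp: defect_def)
    obtain \<gamma> where \<gamma>: "\<gamma> \<in> \<Gamma>" using \<Gamma>(3) by blast
    obtain b where b: "bij_betw b X (X - {\<gamma>})"
      using ordIso_symmetric[OF card_of_diff_finite[OF X, of "{\<gamma>}"]] card_of_ordIso by blast
    then have b': "bij_betw b (ran f) (b ` ran f)" "b ` ran f \<subseteq> X - {\<gamma>}"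
      using ran_subset_carrier[OF fI] by (auto simp: bij_betw_def intro: inj_on_subset)
    then have "b ` ran f \<subseteq> X" by blast
    from partial_bijection_of_bij_betw[OF b'(1) ran_subset_carrier[OF fI] this]
    obtain k where k: "k \<in> sym_inv_monoid X" "dom k = ran f" "ran k = b ` ran f" by blast
    have \<gamma>k: "\<gamma> \<notin> ran k" using b'(2) k(3) by blast
    have "\<not> \<Gamma> \<subseteq> ran k" using \<gamma>k \<gamma> by blast
    then have "k \<in> N" using QI[of k] k(1,2) d by (simp add: collapse_def)
    then have "f' \<cdot> k \<in> N" using f'N subsemigroupD(2)[OF N] by blast
    moreover have "dom (f' \<cdot> k) = X" using total_pcomp[OF f'dom] f'ran k(2) by simp
    moreover have "\<gamma> \<notin> ran (f' \<cdot> k)" using \<gamma>k ran_pcomp_subset[of f' k] by blast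
    ultimately show ?thesis using \<gamma> by blast
  qed
qed

text \<open>
  With a total \<open>e\<close> whose range misses a point of \<open>\<Gamma>\<close>, the factor \<open>pinv e \<cdot> h\<close> of \<open>h\<close> is undefined at
  that point and so belongs to \<open>P\<close>.
\<close>

lemma P_set_supersemigroup:
  assumes X: "infinite X" and \<Gamma>: "finite \<Gamma>" "\<Gamma> \<subseteq> X" "\<Gamma> \<noteq> {}"
    and \<mu>: "Card_order \<mu>" "cinfinite \<mu>"
    and N: "subsemigroup X N" and sub: "P_set X \<Gamma> \<mu> \<subseteq> N" and f: "f \<in> N" "f \<notin> P_set X \<Gamma> \<mu>"
  shows "N = sym_inv_monoid X"
proof
  show "N \<subseteq> sym_inv_monoid X" using subsemigroupD(1)[OF N] .
  obtain e where e: "e \<in> N" "dom e = X" "\<not> \<Gamma> \<subseteq> ran e"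
    using exists_total_missing_point[OF X \<Gamma> \<mu> N _ f] sub by blast
  have eI: "e \<in> sym_inv_monoid X" using e(1) subsemigroupD(1)[OF N] by blast
  show "sym_inv_monoid X \<subseteq> N"
  proof
    fix h assume h: "h \<in> sym_inv_monoid X"
    have "\<not> \<Gamma> \<subseteq> dom (pinv e \<cdot> h)" using e(3) dom_pcomp_subset[of "pinv e" h] unfolding dom_pinv by blast
    then have "pinv e \<cdot> h \<in> N"
      using sub pcomp_closed[OF pinv_closed[OF eI] h] mem_P_set_iff[of "pinv e \<cdot> h" X \<Gamma> \<mu>] by blast
    then have "e \<cdot> (pinv e \<cdot> h) \<in> N" using e(1) subsemigroupD(2)[OF N] by blast
    then show "h \<in> N" using pcomp_pinv_pcomp[OF eI e(2) h] by simp
  qed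
qed

text \<open>
  Here \<open>pinv e \<cdot> h\<close> need not lie in \<open>P \<inter> P\<inverse>\<close>, but \<open>pinv e \<cdot> h \<cdot> e\<close> misses a point of \<open>\<Gamma>\<close> both in its domain
  and in its range; closure under inversion provides the factor \<open>pinv e\<close> that recovers \<open>h\<close>.
\<close>

lemma P_set_Int_pinv_supersemigroup:
  assumes X: "infinite X" and \<Gamma>: "finite \<Gamma>" "\<Gamma> \<subseteq> X" "\<Gamma> \<noteq> {}"
    and \<mu>: "Card_order \<mu>" "cinfinite \<mu>"
    and N: "inverse_subsemigroup X N" and sub: "P_set X \<Gamma> \<mu> \<inter> pinv ` P_set X \<Gamma> \<mu> \<subseteq> N"
    and f: "f \<in> N" "f \<notin> P_set X \<Gamma> \<mu>"
  shows "N = sym_inv_monoid X"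
proof
  have N': "subsemigroup X N" using N by (simp add: inverse_subsemigroup_def)
  show "N \<subseteq> sym_inv_monoid X" using subsemigroupD(1)[OF N'] .
  obtain e where e: "e \<in> N" "dom e = X" "\<not> \<Gamma> \<subseteq> ran e"
    using exists_total_missing_point[OF X \<Gamma> \<mu> N' sub f] by blast
  have eI: "e \<in> sym_inv_monoid X" using e(1) subsemigroupD(1)[OF N'] by blast
  have eN: "pinv e \<in> N" using e(1) N by (simp add: inverse_subsemigroup_def)
  show "sym_inv_monoid X \<subseteq> N"
  proof
    fix h assume h: "h \<in> sym_inv_monoid X"
    let ?k = "pinv e \<cdot> (h \<cdot> e)"
    have he: "h \<cdot> e \<in> sym_inv_monoid X" using pcomp_closed[OF h eI] .
    have k: "?k \<in> sym_inv_monoid X" using pcomp_closed[OF pinv_closed[OF eI] he] .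
    have "\<not> \<Gamma> \<subseteq> dom ?k" using e(3) dom_pcomp_subset[of "pinv e" "h \<cdot> e"] unfolding dom_pinv by blast
    moreover have "\<not> \<Gamma> \<subseteq> ran ?k"
      using e(3) ran_pcomp_subset[of "pinv e" "h \<cdot> e"] ran_pcomp_subset[of h e] by blast
    ultimately have "?k \<in> P_set X \<Gamma> \<mu>" "?k \<in> pinv ` P_set X \<Gamma> \<mu>"
      using k by (simp_all only: mem_P_set_iff mem_pinv_image_P_set_iff[OF \<Gamma>(1)] simp_thms)
    then have "?k \<in> N" using sub by blast
    then have "e \<cdot> ?k \<cdot> pinv e \<in> N" using e(1) eN subsemigroupD(2)[OF N'] by blast
    moreover have "e \<cdot> ?k \<cdot> pinv e = h"
    proof -
      have "e \<cdot> ?k = h \<cdot> e" using pcomp_pinv_pcomp[OF eI e(2) he] .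
      moreover have "pinv (h \<cdot> e \<cdot> pinv e) = pinv h"
        using pcomp_pinv_pcomp[OF eI e(2) pinv_closed[OF h]]
        by (simp add: pinv_pcomp[OF he pinv_closed[OF eI]] pinv_pcomp[OF h eI] pinv_pinv[OF eI])
      then have "h \<cdot> e \<cdot> pinv e = h"
        using pinv_pinv[OF h] pinv_pinv[OF pcomp_closed[OF he pinv_closed[OF eI]]] by simp
      ultimately show ?thesis by simp
    qed
    ultimately show "h \<in> N" by simp
  qed
qed

section \<open>Everywhere defined elements of a semigroup containing the stabiliser\<close>

definition total_elements :: "'a set \<Rightarrow> ('a \<rightharpoonup> 'a) set \<Rightarrow> ('a \<rightharpoonup> 'a) set" where
  "total_elements X M = {h \<in> M. dom h = X}"

lemma total_elements_pcomp:
  assumes M: "subsemigroup X M" and h: "h \<in> total_elements X M" and f: "f \<in> M" "ran h \<subseteq> dom f"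
  shows "h \<cdot> f \<in> total_elements X M"
  using h f subsemigroupD(2)[OF M, of h f] dom_pcomp_total[OF f(2)] by (simp add: total_elements_def)

lemma total_elementsD:
  assumes M: "subsemigroup X M" and h: "h \<in> total_elements X M"
  shows "h \<in> M" "h \<in> sym_inv_monoid X" "dom h = X" "ran h \<subseteq> X"
  using h subsemigroupD(1)[OF M] ran_subset_carrier[of h X] by (auto simp: total_elements_def)

lemma total_elements_pcomp':
  assumes M: "subsemigroup X M" and h: "h \<in> total_elements X M" and f: "f \<in> total_elements X M"
  shows "h \<cdot> f \<in> total_elements X M"
  using total_elements_pcomp[OF M h] total_elementsD[OF M f] total_elementsD[OF M h] by simp

text \<open>
  By injectivity, \<open>g\<close> carries points that \<open>h\<close> misses to points that \<open>h \<cdot> g\<close> misses.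
\<close>

lemma pimage_compl_subset:
  assumes g: "g \<in> sym_inv_monoid X"
  shows "pimage g (X - ran h) \<subseteq> X - ran (h \<cdot> g)"
proof
  fix z assume "z \<in> pimage g (X - ran h)"
  then obtain y where y: "y \<notin> ran h" "g y = Some z" by (auto simp: mem_pimage_iff)
  have "z \<notin> ran (h \<cdot> g)"
  proof
    assume "z \<in> ran (h \<cdot> g)"
    then obtain y' where "y' \<in> ran h" "g y' = Some z" by (auto simp: ran_pcomp mem_pimage_iff)
    then show False using sym_inv_monoidD(3)[OF g y(2)] y(1) by blast
  qed
  then show "z \<in> X - ran (h \<cdot> g)" using sym_inv_monoidD(2)[OF g y(2)] by blast
qed

lemma defect_le_defect_pcomp:
  assumes g: "g \<in> sym_inv_monoid X" and "dom g = X"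
  shows "|X - ran h| \<le>o |X - ran (h \<cdot> g)|"
proof -
  have "|X - ran h| =o |pimage g (X - ran h)|" using assms(2) by (intro card_pimage_ordIso[OF g]) simp
  then show ?thesis using card_of_mono1[OF pimage_compl_subset[OF g]] ordIso_ordLeq_trans by blast
qed

text \<open>
  The defects of the powers of \<open>e\<close> grow without bound: each further factor adds to the images of the
  points missed so far a point \<open>z\<close> that \<open>e\<close> misses.
\<close>

lemma exists_total_finite_defect:
  assumes M: "subsemigroup X M" and e: "e \<in> total_elements X M" "ran e \<noteq> X"
  shows "\<exists>h \<in> total_elements X M. \<exists>B \<subseteq> X - ran h. finite B \<and> card B = n"
proof (induction n)
  case 0
  then show ?case using e(1) by (intro bexI[of _ e] exI[of _ "{}"]) auto
next
  case (Suc n)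
  then obtain h B where h: "h \<in> total_elements X M" and B: "B \<subseteq> X - ran h" "finite B" "card B = n"
    by blast
  note eD = total_elementsD[OF M e(1)]
  obtain z where z: "z \<in> X" "z \<notin> ran e" using e(2) eD(4) by blast
  let ?B = "insert z (pimage e B)"
  have "pimage e B \<subseteq> pimage e (X - ran h)" using B(1) unfolding pimage_eq_image by blast
  then have "?B \<subseteq> X - ran (h \<cdot> e)"
    using pimage_compl_subset[OF eD(2), of h] z ran_pcomp_subset[of h e] by blast
  moreover have "z \<notin> pimage e B" using z(2) by (auto simp: mem_pimage_iff ran_def)
  moreover have "card (pimage e B) = card B"
  proof -
    have "B \<inter> dom e = B" using B(1) eD(3) by blast
    then show ?thesis using card_image[OF inj_on_the[OF eD(2), of B]] by (simp add: pimage_eq_image)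
  qed
  moreover have "finite (pimage e B)" using B(2) by (simp add: pimage_eq_image)
  ultimately have "?B \<subseteq> X - ran (h \<cdot> e) \<and> finite ?B \<and> card ?B = Suc n" using B(3) by simp
  then show ?case using total_elements_pcomp'[OF M h e(1)] by blast
qed

lemma pimage_subset_ran: "pimage f A \<subseteq> ran f"
  by (auto simp: mem_pimage_iff intro: ranI)

lemma pimage_pinv_pimage:
  assumes f: "f \<in> sym_inv_monoid X" and A: "A \<subseteq> dom f"
  shows "pimage (pinv f) (pimage f A) = A"
proof (intro set_eqI iffI)
  fix x assume "x \<in> pimage (pinv f) (pimage f A)"
  then obtain y where y: "y \<in> pimage f A" "f x = Some y"
    using f by (auto simp: mem_pimage_iff pinv_eq_Some_iff)
  from y(1) obtain x' where "x' \<in> A" "f x' = Some y" by (auto simp: mem_pimage_iff)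
  then show "x \<in> A" using sym_inv_monoidD(3)[OF f y(2)] by blast
next
  fix x assume x: "x \<in> A"
  then obtain y where y: "f x = Some y" using A by blast
  then have "y \<in> pimage f A" using x by (auto simp: mem_pimage_iff)
  then show "x \<in> pimage (pinv f) (pimage f A)" using y f by (auto simp: mem_pimage_iff pinv_eq_Some_iff)
qed

text \<open>
  Let \<open>\<Gamma>\<close> be a trace of least size that the range of a total element of \<open>M\<close> leaves on \<open>\<Sigma>\<close>, and let \<open>h\<close> be a total
  element with trace \<open>\<Gamma>\<close>.  For every total \<open>k\<close> the product \<open>k \<cdot> h\<close> has trace \<open>\<Gamma>\<close> again by minimality,
  so the preimage of \<open>\<Gamma>\<close> under \<open>h\<close> is contained in the range of every total \<open>k\<close>.  A point outside
  \<open>\<Sigma>\<close> has no such property, because some \<open>k\<close> misses a point outside \<open>\<Sigma>\<close> and the stabiliser can move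
  that point anywhere outside \<open>\<Sigma>\<close>.  Hence the preimage lies in \<open>\<Sigma>\<close> and in the range of \<open>h\<close>, that is,
  in \<open>\<Gamma>\<close>, and \<open>h\<close> maps \<open>\<Gamma>\<close> onto itself.  For an arbitrary total \<open>h\<close> the product \<open>h \<cdot> g\<close> has trace \<open>\<Gamma>\<close>,
  so \<open>g\<close> and \<open>h \<cdot> g\<close> both map \<open>\<Gamma>\<close> onto itself, and so does \<open>h\<close>.
\<close>

lemma exists_minimal_trace:
  assumes X: "infinite X" and \<Sigma>: "finite \<Sigma>" "\<Sigma> \<subseteq> X"
    and M: "subsemigroup X M" and stab: "pointwise_stabiliser X \<Sigma> \<subseteq> M"
    and e: "e \<in> total_elements X M" "ran e \<noteq> X"
  shows "\<exists>g \<in> total_elements X M. \<forall>h \<in> total_elements X M. pimage h (ran g \<inter> \<Sigma>) = ran g \<inter> \<Sigma>"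
proof -
  let ?T = "total_elements X M"
  obtain g where g: "g \<in> ?T" and min: "\<And>h. h \<in> ?T \<Longrightarrow> card (ran g \<inter> \<Sigma>) \<le> card (ran h \<inter> \<Sigma>)"
    using ex_has_least_nat[of "\<lambda>h. h \<in> ?T" e "\<lambda>h. card (ran h \<inter> \<Sigma>)"] e(1) by blast
  define \<Gamma> where "\<Gamma> = ran g \<inter> \<Sigma>"
  note gD = total_elementsD[OF M g]
  have fin: "finite \<Gamma>" using \<Sigma>(1) by (simp add: \<Gamma>_def)
  have self: "ran h \<inter> \<Sigma> = \<Gamma> \<Longrightarrow> pimage h \<Gamma> = \<Gamma>" if h: "h \<in> ?T" for h
  proof -
    assume hr: "ran h \<inter> \<Sigma> = \<Gamma>"
    note hD = total_elementsD[OF M h]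
    have hit: "y \<in> ran k" if k: "k \<in> ?T" and y: "h y = Some \<gamma>" "\<gamma> \<in> \<Gamma>" for k y \<gamma>
    proof -
      have sub: "ran (k \<cdot> h) \<inter> \<Sigma> \<subseteq> \<Gamma>" using ran_pcomp_subset[of k h] hr by blast
      have "card \<Gamma> \<le> card (ran (k \<cdot> h) \<inter> \<Sigma>)"
        using min[OF total_elements_pcomp'[OF M k h]] by (simp add: \<Gamma>_def)
      then have "ran (k \<cdot> h) \<inter> \<Sigma> = \<Gamma>" using sub fin by (intro card_seteq)
      then obtain y' where "y' \<in> ran k" "h y' = Some \<gamma>"
        using y(2) by (auto simp: ran_pcomp mem_pimage_iff)
      then show ?thesis using sym_inv_monoidD(3)[OF hD(2) y(1)] by blast
    qed
    have pre: "y \<in> \<Gamma>" if y: "h y = Some \<gamma>" "\<gamma> \<in> \<Gamma>" for y \<gamma>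
    proof -
      have "y \<in> \<Sigma>"
      proof (rule ccontr)
        assume y\<Sigma>: "y \<notin> \<Sigma>"
        have yX: "y \<in> X" using sym_inv_monoidD(1)[OF hD(2) y(1)] .
        \<comment> \<open>Missing more than \<open>card \<Sigma>\<close> points, \<open>k\<close> misses one outside \<open>\<Sigma>\<close>.\<close>
        obtain k B where k: "k \<in> ?T" and B: "B \<subseteq> X - ran k" "finite B" "card B = Suc (card \<Sigma>)"
          using exists_total_finite_defect[OF M e] by blast
        have "\<not> B \<subseteq> \<Sigma>" using B(3) card_mono[OF \<Sigma>(1), of B] by auto
        then obtain z where z: "z \<in> X" "z \<notin> ran k" "z \<notin> \<Sigma>" using B(1) by blast
        have "\<exists>s \<in> pointwise_stabiliser X \<Sigma>. [z \<mapsto> y] \<subseteq>\<^sub>m s"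
        proof (rule exists_stabiliser_extension)
          show "[z \<mapsto> y] \<in> sym_inv_monoid X" using z(1) yX by (simp add: sym_inv_monoid_def)
          have "infinite (X - \<Sigma>)" using X \<Sigma>(1) by simp
          then have "|X - \<Sigma> - {z}| =o |X - \<Sigma>|" "|X - \<Sigma> - {y}| =o |X - \<Sigma>|"
            by (intro card_of_diff_finite; simp)+
          then have "|X - \<Sigma> - {z}| =o |X - \<Sigma> - {y}|"
            using ordIso_symmetric ordIso_transitive by blast
          then show "|X - \<Sigma> - dom [z \<mapsto> y]| =o |X - \<Sigma> - ran [z \<mapsto> y]|" by simp
        qed (use z(3) y\<Sigma> \<Sigma>(2) in auto)
        then obtain s where s: "s \<in> pointwise_stabiliser X \<Sigma>" "s z = Some y"
          by (auto simp: map_le_def)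
        have sT: "s \<in> ?T" using s(1) stab by (auto simp: total_elements_def pointwise_stabiliser_def sym_group_def)
        have "y \<in> ran (k \<cdot> s)" using hit[OF total_elements_pcomp'[OF M k sT] y] .
        then obtain z' where "z' \<in> ran k" "s z' = Some y" by (auto simp: ran_pcomp mem_pimage_iff)
        then show False using sym_inv_monoidD(3)[OF total_elementsD(2)[OF M sT] s(2)] z(2) by blast
      qed
      then show ?thesis using hit[OF h y] hr by blast
    qed
    have "\<Gamma> \<subseteq> pimage h \<Gamma>"
    proof
      fix \<gamma> assume \<gamma>: "\<gamma> \<in> \<Gamma>"
      then obtain y where y: "h y = Some \<gamma>" using hr by (auto simp: ran_def)
      then show "\<gamma> \<in> pimage h \<Gamma>" using pre[OF y \<gamma>] by (auto simp: mem_pimage_iff)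
    qed
    then show "pimage h \<Gamma> = \<Gamma>" by (rule finite_subset_pimage_imp_eq[OF fin])
  qed
  have "pimage h \<Gamma> = \<Gamma>" if h: "h \<in> ?T" for h
  proof -
    note hD = total_elementsD[OF M h]
    have T: "h \<cdot> g \<in> ?T" using total_elements_pcomp'[OF M h g] .
    have "ran (h \<cdot> g) \<inter> \<Sigma> \<subseteq> \<Gamma>" using ran_pcomp_subset[of h g] by (auto simp: \<Gamma>_def)
    moreover have "card \<Gamma> \<le> card (ran (h \<cdot> g) \<inter> \<Sigma>)" using min[OF T] by (simp add: \<Gamma>_def)
    ultimately have "ran (h \<cdot> g) \<inter> \<Sigma> = \<Gamma>" using fin by (intro card_seteq)
    then have eq: "pimage g (pimage h \<Gamma>) = \<Gamma>" using self[OF T] by (simp add: pimage_pcomp)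
    have "pimage h \<Gamma> \<subseteq> dom g" using pimage_subset_ran[of h \<Gamma>] hD(4) gD(3) by simp
    then have "pimage (pinv g) (pimage g (pimage h \<Gamma>)) = pimage h \<Gamma>"
      by (rule pimage_pinv_pimage[OF gD(2)])
    then show ?thesis
      using eq finite_pimage_eqD(3)[OF gD(2) fin self[OF g]] by (simp add: \<Gamma>_def)
  qed
  then show ?thesis using g unfolding \<Gamma>_def by blast
qed

text \<open>
  The cardinal \<open>\<mu>\<close> is the least infinite one above the defects of all total elements, which exists
  because the successor of \<open>|X|\<close> is above all of them.  By minimality every smaller infinite cardinal
  is bounded by a defect; finite ones are bounded by \<open>exists_total_finite_defect\<close>.
\<close>

lemma exists_critical_cardinal:
  fixes X :: "'a set"
  assumes X: "infinite X" and M: "subsemigroup X M" and e: "e \<in> total_elements X M" "ran e \<noteq> X"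
  shows "\<exists>\<mu> :: 'a set rel. Card_order \<mu> \<and> cinfinite \<mu> \<and> \<mu> \<le>o cardSuc |X| \<and>
           (\<forall>h \<in> total_elements X M. |X - ran h| <o \<mu>) \<and>
           (\<forall>A \<subseteq> X. |A| <o \<mu> \<longrightarrow> (\<exists>h \<in> total_elements X M. |A| \<le>o |X - ran h| ))"
proof -
  let ?T = "total_elements X M"
  let ?S = "{\<mu> :: 'a set rel. Card_order \<mu> \<and> cinfinite \<mu> \<and> \<mu> \<le>o cardSuc |X| \<and> (\<forall>h \<in> ?T. |X - ran h| <o \<mu>)}"
  have Xlt: "|X| <o cardSuc |X|" by (rule cardSuc_greater) (rule card_of_Card_order)
  have "cardSuc |X| \<in> ?S"
  proof -
    have "Card_order (cardSuc |X| )" by (rule cardSuc_Card_order) (rule card_of_Card_order)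
    moreover have "cinfinite (cardSuc |X| )"
      using X cardSuc_finite[OF card_of_Card_order, of X] by (simp add: cinfinite_def Field_card_of)
    moreover have "|X - ran h| <o cardSuc |X|" for h :: "'a \<rightharpoonup> 'a"
      using ordLeq_ordLess_trans[OF card_of_mono1[OF Diff_subset] Xlt] .
    ultimately show ?thesis
      using ordLeq_reflexive[of "cardSuc |X|"] by (simp add: card_order_on_well_order_on)
  qed
  then obtain \<mu> where \<mu>: "\<mu> \<in> ?S" and min: "\<And>\<nu>. \<nu> <o \<mu> \<Longrightarrow> \<nu> \<notin> ?S"
    using wfE_min[OF wf_ordLess, of "cardSuc |X|" ?S] by (metis (no_types, lifting))
  have "\<exists>h \<in> ?T. |A| \<le>o |X - ran h|" if A: "A \<subseteq> X" "|A| <o \<mu>" for A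
  proof (cases "finite A")
    case True
    obtain h B where h: "h \<in> ?T" "B \<subseteq> X - ran h" "finite B" "card B = card A"
      using exists_total_finite_defect[OF M e] by blast
    have "\<exists>f. bij_betw f A B" using h(3,4) True by (metis finite_same_card_bij)
    then have "|A| =o |B|" using card_of_ordIso by blast
    then have "|A| \<le>o |X - ran h|" using card_of_mono1[OF h(2)] ordIso_ordLeq_trans by blast
    then show ?thesis using h(1) by blast
  next
    case False
    \<comment> \<open>The cardinality of \<open>A\<close>, carried over to the type of \<open>\<mu>\<close> so that minimality applies to it.\<close>
    let ?\<nu> = "|(\<lambda>x. {x}) ` A|"
    have iso: "|A| =o ?\<nu>" by (rule card_of_ordIsoI[of "\<lambda>x. {x}"]) (simp add: bij_betw_def inj_on_def)
    have "Card_order ?\<nu>" by (rule card_of_Card_order)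
    moreover have "cinfinite ?\<nu>"
      using False card_of_ordIso_finite[OF iso] by (simp add: cinfinite_def Field_card_of)
    moreover have "?\<nu> \<le>o cardSuc |X|"
      by (rule ordIso_ordLeq_trans[OF ordIso_symmetric[OF iso]
            ordLeq_transitive[OF card_of_mono1[OF A(1)] ordLess_imp_ordLeq[OF Xlt]]])
    moreover have "?\<nu> <o \<mu>" using ordIso_ordLess_trans[OF ordIso_symmetric[OF iso] A(2)] .
    ultimately obtain h where h: "h \<in> ?T" "\<not> |X - ran h| <o ?\<nu>" using min[of ?\<nu>] by blast
    then have "?\<nu> \<le>o |X - ran h|" using card_not_ordLeq_iff[of ?\<nu> "X - ran h"] card_of_Card_order by blast
    then show ?thesis using h(1) ordIso_ordLeq_trans[OF iso] by blast
  qed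
  then show ?thesis using \<mu> by blast
qed

text \<open>
  Cancellation of a finite summand.  It is needed because the room for moving sets around by the
  stabiliser is \<open>X - \<Sigma>\<close> and not \<open>X\<close>, which matters when the cardinals involved are finite.
\<close>

lemma ordLeq_diff_finite:
  assumes "finite \<Sigma>" "finite A" "finite A'" "card A' = card A + card \<Sigma>" "|A'| \<le>o |Y|"
  shows "|A| \<le>o |Y - \<Sigma>|"
proof (cases "finite Y")
  case True
  have "card A' \<le> card Y"
    using assms(5) True card_of_ordLeq[of A' Y] card_inj_on_le[of _ A' Y] by blast
  then have "card A \<le> card (Y - \<Sigma>)" using assms(4) diff_card_le_card_Diff[OF assms(1), of Y] by linarith
  then obtain f where "f ` A \<subseteq> Y - \<Sigma>" "inj_on f A"
    using card_le_inj[OF assms(2), of "Y - \<Sigma>"] True by blast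
  then show ?thesis using card_of_ordLeqI by blast
next
  case False
  then have "infinite (Y - \<Sigma>)" using assms(1) by simp
  then have "|A| <o |Y - \<Sigma>|"
    using assms(2) by (intro finite_ordLess) (simp_all add: card_of_card_order_on cinfinite_def Field_card_of)
  then show ?thesis by (rule ordLess_imp_ordLeq)
qed

text \<open>
  An injection of the points outside \<open>B\<close> into the points outside \<open>A\<close> extends to an element of the
  stabiliser, both remainders having full size.  That element sends everything outside \<open>B\<close> to
  points outside \<open>A\<close>, so its inverse sends \<open>A\<close> into \<open>B\<close>.
\<close>

lemma exists_stabiliser_into:
  assumes X: "infinite X" and \<Sigma>: "finite \<Sigma>" "\<Sigma> \<subseteq> X"
    and A: "A \<subseteq> X" "|A| =o |X|" and B: "B \<subseteq> X" "|B| =o |X|"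
    and sub: "A \<inter> \<Sigma> \<subseteq> B" and le: "|X - \<Sigma> - B| \<le>o |X - \<Sigma> - A|"
  shows "\<exists>s \<in> pointwise_stabiliser X \<Sigma>. pimage s A \<subseteq> B"
proof -
  obtain j where j: "inj_on j (X - \<Sigma> - B)" "j ` (X - \<Sigma> - B) \<subseteq> X - \<Sigma> - A"
    using card_of_ordLeq[THEN iffD2, OF le] by blast
  let ?D = "X - \<Sigma> - B" and ?J = "j ` (X - \<Sigma> - B)"
  have jb: "bij_betw j ?D ?J" using j(1) by (simp add: bij_betw_def)
  have D: "?D \<subseteq> X" by blast
  have J: "?J \<subseteq> X" using j(2) by (rule order_trans) blast
  from partial_bijection_of_bij_betw[OF jb D J]
  obtain q where q: "q \<in> sym_inv_monoid X" "dom q = ?D" "ran q = ?J" by blast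
  have full: "|X - \<Sigma> - D| =o |X|" if D: "E - \<Sigma> \<subseteq> X - \<Sigma> - D" "|E| =o |X|" for D E
  proof -
    have "infinite E" using X card_of_ordIso_finite[OF D(2)] by blast
    then have "|E - \<Sigma>| =o |X|" using card_of_diff_finite[OF _ \<Sigma>(1)] D(2) ordIso_transitive by blast
    then have "|X| \<le>o |X - \<Sigma> - D|" using card_of_mono1[OF D(1)] ordIso_symmetric ordIso_ordLeq_trans by blast
    moreover have "|X - \<Sigma> - D| \<le>o |X|" by (rule card_of_mono1) blast
    ultimately show ?thesis by (simp add: ordIso_iff_ordLeq)
  qed
  have "|X - \<Sigma> - ?D| =o |X|" using B by (intro full[of B]) auto
  moreover have "|X - \<Sigma> - ?J| =o |X|" using A j(2) by (intro full[of A]) auto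
  ultimately have "|X - \<Sigma> - dom q| =o |X - \<Sigma> - ran q|"
    using q(2,3) ordIso_symmetric ordIso_transitive by metis
  moreover have "dom q \<inter> \<Sigma> = {}" "ran q \<inter> \<Sigma> = {}" using q(2,3) j(2) by auto
  ultimately obtain t where t: "t \<in> pointwise_stabiliser X \<Sigma>" "q \<subseteq>\<^sub>m t"
    using exists_stabiliser_extension[OF q(1) _ _ \<Sigma>(2)] by blast
  have tI: "t \<in> sym_inv_monoid X" "ran t = X" and t\<Sigma>: "\<forall>x\<in>\<Sigma>. t x = Some x"
    using t(1) by (auto simp: pointwise_stabiliser_def sym_group_def)
  have "pinv t \<in> pointwise_stabiliser X \<Sigma>" using t(1) pinv_image_pointwise_stabiliser by blast
  moreover have "pimage (pinv t) A \<subseteq> B"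
  proof
    fix x assume "x \<in> pimage (pinv t) A"
    then obtain a where a: "a \<in> A" "t x = Some a" using tI(1) by (auto simp: mem_pimage_iff pinv_eq_Some_iff)
    have xX: "x \<in> X" using sym_inv_monoidD(1)[OF tI(1) a(2)] .
    show "x \<in> B"
    proof (cases "x \<in> \<Sigma>")
      case True
      then have "a = x" using t\<Sigma> a(2) by simp
      then show ?thesis using True a(1) sub by blast
    next
      case False
      show ?thesis
      proof (rule ccontr)
        assume "x \<notin> B"
        then have "x \<in> dom q" using False xX q(2) by blast
        then obtain y where y: "q x = Some y" by blast
        then have "y \<in> ?J" using q(3) by (auto simp: ran_def)
        moreover have "t x = Some y" using t(2) y by (metis domI map_le_def)
        ultimately show False using a j(2) by auto
      qed
    qed
  qed
  ultimately show ?thesis by blast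
qed

text \<open>
  With the minimal trace \<open>\<Gamma>\<close> and the critical cardinal \<open>\<mu>\<close>, the semigroup \<open>M\<close> is contained in
  \<open>P_set X \<Gamma> \<mu>\<close>: otherwise a suitable \<open>h \<cdot> s \<cdot> f\<close> is a total element that moves \<open>\<Gamma>\<close> or has defect at
  least \<open>\<mu>\<close>.  The hypothesis on \<open>M\<close> then leaves only \<open>\<Gamma> = {}\<close> and \<open>\<mu> > |X|\<close>, so the whole of \<open>X\<close> is
  bounded by the defect of some total element whose range avoids \<open>\<Sigma>\<close>.
\<close>

lemma exists_spreading_element:
  fixes X :: "'a set"
  assumes X: "infinite X" and \<Sigma>: "finite \<Sigma>" "\<Sigma> \<subseteq> X"
    and M: "subsemigroup X M" and stab: "pointwise_stabiliser X \<Sigma> \<subseteq> M"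
    and e: "e \<in> total_elements X M" "ran e \<noteq> X"
    and not_in: "\<And>\<Gamma> (\<mu> :: 'a set rel). \<lbrakk>\<Gamma> \<subseteq> \<Sigma>; Card_order \<mu>; cinfinite \<mu>; \<mu> \<le>o cardSuc |X|;
      \<Gamma> \<noteq> {} \<or> \<mu> \<le>o |X|\<rbrakk> \<Longrightarrow> \<not> M \<subseteq> P_set X \<Gamma> \<mu>"
  shows "\<exists>u \<in> total_elements X M. ran u \<inter> \<Sigma> = {} \<and> |X - \<Sigma> - ran u| =o |X|"
proof -
  let ?T = "total_elements X M"
  obtain g where g: "g \<in> ?T" and inv: "\<And>h. h \<in> ?T \<Longrightarrow> pimage h (ran g \<inter> \<Sigma>) = ran g \<inter> \<Sigma>"
    using exists_minimal_trace[OF X \<Sigma> M stab e] by blast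
  define \<Gamma> where "\<Gamma> = ran g \<inter> \<Sigma>"
  note inv = inv[folded \<Gamma>_def]
  note gD = total_elementsD[OF M g]
  obtain \<mu> :: "'a set rel" where \<mu>: "Card_order \<mu>" "cinfinite \<mu>" "\<mu> \<le>o cardSuc |X|"
    and small: "\<And>h. h \<in> ?T \<Longrightarrow> |X - ran h| <o \<mu>"
    and large: "\<And>A. \<lbrakk>A \<subseteq> X; |A| <o \<mu>\<rbrakk> \<Longrightarrow> \<exists>h \<in> ?T. |A| \<le>o |X - ran h|"
    using exists_critical_cardinal[OF X M e] by blast
  have room: "\<exists>h \<in> ?T. ran h \<inter> \<Sigma> = \<Gamma> \<and> |A| \<le>o |X - \<Sigma> - ran h|" if A: "A \<subseteq> X" "|A| <o \<mu>" for A
  proof -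
    \<comment> \<open>Multiplying by \<open>g\<close> on the right cuts the trace down to \<open>\<Gamma>\<close> and does not decrease the defect.\<close>
    have large': "\<exists>h \<in> ?T. ran h \<inter> \<Sigma> = \<Gamma> \<and> |A'| \<le>o |X - ran h|" if A': "A' \<subseteq> X" "|A'| <o \<mu>" for A'
    proof -
      obtain h where h: "h \<in> ?T" "|A'| \<le>o |X - ran h|" using large[OF A'] by blast
      have T: "h \<cdot> g \<in> ?T" using total_elements_pcomp'[OF M h(1) g] .
      have "\<Gamma> \<subseteq> ran (h \<cdot> g)" using inv[OF T] by (metis mem_pimage_iff ranI subsetI)
      then have "ran (h \<cdot> g) \<inter> \<Sigma> = \<Gamma>" using ran_pcomp_subset[of h g] by (auto simp: \<Gamma>_def)
      moreover have "|A'| \<le>o |X - ran (h \<cdot> g)|"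
        using ordLeq_transitive[OF h(2) defect_le_defect_pcomp[OF gD(2,3)]] .
      ultimately show ?thesis using T by blast
    qed
    have comm: "X - ran h - \<Sigma> = X - \<Sigma> - ran h" for h :: "'a \<rightharpoonup> 'a" by blast
    show ?thesis
    proof (cases "finite A")
      case True
      \<comment> \<open>The extra \<open>card \<Sigma>\<close> points make up for the missed points that happen to lie in \<open>\<Sigma>\<close>.\<close>
      obtain A' where A': "A' \<subseteq> X" "finite A'" "card A' = card A + card \<Sigma>"
        using infinite_arbitrarily_large[OF X] by blast
      obtain h where h: "h \<in> ?T" "ran h \<inter> \<Sigma> = \<Gamma>" "|A'| \<le>o |X - ran h|"
        using large'[OF A'(1) finite_ordLess[OF A'(2) \<mu>(1,2)]] by blast
      then show ?thesis using ordLeq_diff_finite[OF \<Sigma>(1) True A'(2,3) h(3)] comm by auto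
    next
      case False
      obtain h where h: "h \<in> ?T" "ran h \<inter> \<Sigma> = \<Gamma>" "|A| \<le>o |X - ran h|"
        using large'[OF A] by blast
      have "infinite (X - ran h)" using card_of_ordLeq_infinite[OF h(3) False] .
      then have "|X - ran h| =o |X - \<Sigma> - ran h|"
        using ordIso_symmetric[OF card_of_diff_finite[OF _ \<Sigma>(1)]] comm by metis
      then show ?thesis using h ordLeq_ordIso_trans by blast
    qed
  qed
  have contained: "M \<subseteq> P_set X \<Gamma> \<mu>"
  proof
    fix f assume f: "f \<in> M"
    have fI: "f \<in> sym_inv_monoid X" using f subsemigroupD(1)[OF M] by blast
    show "f \<in> P_set X \<Gamma> \<mu>"
    proof (rule ccontr)
      assume "f \<notin> P_set X \<Gamma> \<mu>"
      then have c: "|X - dom f| <o \<mu>" and dom: "\<Gamma> \<subseteq> dom f" and rank: "f \<notin> small_rank X"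
        and bad: "\<not> (pimage f \<Gamma> = \<Gamma> \<and> defect X f <o \<mu>)"
        using fI card_not_ordLeq_iff[OF \<mu>(1), of "X - dom f"] by (auto simp: mem_P_set_iff collapse_def)
      obtain h where h: "h \<in> ?T" "ran h \<inter> \<Sigma> = \<Gamma>" "|X - dom f| \<le>o |X - \<Sigma> - ran h|"
        using room[OF Diff_subset c] by blast
      note hD = total_elementsD[OF M h(1)]
      have "|X - \<Sigma> - dom f| \<le>o |X - dom f|" by (rule card_of_mono1) blast
      then have le: "|X - \<Sigma> - dom f| \<le>o |X - \<Sigma> - ran h|" using h(3) ordLeq_transitive by blast
      have hX: "|ran h| =o |X|" using ordIso_symmetric[OF card_dom_ordIso_ran[OF hD(2)]] hD(3) by simp
      have fX: "dom f \<subseteq> X" using fI by (simp add: sym_inv_monoid_def)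
      have "ran h \<inter> \<Sigma> \<subseteq> dom f" using h(2) dom by simp
      from exists_stabiliser_into[OF X \<Sigma> hD(4) hX fX not_small_rank_dom[OF fI rank] this le]
      obtain s where s: "s \<in> pointwise_stabiliser X \<Sigma>" "pimage s (ran h) \<subseteq> dom f" by blast
      have sT: "s \<in> ?T" using s(1) stab by (auto simp: total_elements_def pointwise_stabiliser_def sym_group_def)
      have hs: "h \<cdot> s \<in> ?T" using total_elements_pcomp'[OF M h(1) sT] .
      have T: "h \<cdot> s \<cdot> f \<in> ?T"
        using total_elements_pcomp[OF M hs f] s(2) by (simp add: ran_pcomp)
      have "pimage f \<Gamma> = \<Gamma>" using inv[OF T] inv[OF hs] by (simp add: pimage_pcomp[of "h \<cdot> s"])
      moreover have "defect X f <o \<mu>"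
        using ordLeq_ordLess_trans[OF defect_pcomp_ge[of X f "h \<cdot> s"]] small[OF T] by (simp add: defect_def)
      ultimately show False using bad by blast
    qed
  qed
  have \<Gamma>\<Sigma>: "\<Gamma> \<subseteq> \<Sigma>" by (simp add: \<Gamma>_def)
  have \<Gamma>: "\<Gamma> = {}" and "\<not> \<mu> \<le>o |X|" using not_in[OF \<Gamma>\<Sigma> \<mu>] contained by blast+
  then have "|X| <o \<mu>" using card_not_ordLeq_iff[OF \<mu>(1)] by blast
  then obtain u where u: "u \<in> ?T" "ran u \<inter> \<Sigma> = {}" "|X| \<le>o |X - \<Sigma> - ran u|"
    using room[OF subset_refl] \<Gamma> by blast
  moreover have "|X - \<Sigma> - ran u| \<le>o |X|" by (rule card_of_mono1) blast
  ultimately show ?thesis by (auto simp: ordIso_iff_ordLeq)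
qed

text \<open>
  Transporting a permutation \<open>p\<close> along \<open>u\<close> and \<open>v\<close> gives the partial bijection \<open>pinv u \<cdot> p \<cdot> v\<close> from the range
  of \<open>u\<close> to that of \<open>v\<close>.  Both ranges avoid \<open>\<Sigma>\<close> and leave \<open>|X|\<close> points uncovered, so it extends to an
  element \<open>s\<close> of the stabiliser, and \<open>p = u \<cdot> s \<cdot> pinv v\<close>.
\<close>

lemma sym_group_subset:
  assumes \<Sigma>: "\<Sigma> \<subseteq> X"
    and M: "subsemigroup X M" and stab: "pointwise_stabiliser X \<Sigma> \<subseteq> M"
    and u: "u \<in> total_elements X M" "ran u \<inter> \<Sigma> = {}" "|X - \<Sigma> - ran u| =o |X|"
    and v: "v \<in> total_elements X (pinv ` M)" "ran v \<inter> \<Sigma> = {}" "|X - \<Sigma> - ran v| =o |X|"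
  shows "sym_group X \<subseteq> M"
proof
  fix p assume p: "p \<in> sym_group X"
  then have pI: "p \<in> sym_inv_monoid X" and pd: "dom p = X" and pr: "ran p = X" by (auto simp: sym_group_def)
  note uD = total_elementsD[OF M u(1)]
  note vD = total_elementsD[OF subsemigroup_pinv_image[OF M] v(1)]
  have vM: "pinv v \<in> M" using pinv_image_iff[OF subsemigroupD(1)[OF M] vD(2)] vD(1) by simp
  define q where "q = pinv u \<cdot> p \<cdot> v"
  have "pinv u \<cdot> p \<in> sym_inv_monoid X" using pcomp_closed[OF pinv_closed[OF uD(2)] pI] .
  then have qI: "q \<in> sym_inv_monoid X" using pcomp_closed[OF _ vD(2)] by (simp add: q_def)
  have qe: "q y = Some z \<longleftrightarrow> (\<exists>x w. u x = Some y \<and> p x = Some w \<and> v w = Some z)" for y z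
    unfolding q_def pcomp_eq_Some_iff pinv_eq_Some_iff[OF uD(2)] by blast
  have up: "ran (pinv u) = dom p" using ran_pinv[OF uD(2)] uD(3) pd by simp
  have rp: "ran (pinv u \<cdot> p) = X"
    using pr by (simp only: ran_pcomp up pimage_dom)
  have dq: "dom q = ran u"
    using rp up vD(3) by (simp add: q_def dom_pcomp_total dom_pinv)
  have rq: "ran q = ran v"
    using pimage_dom[of v] vD(3) by (simp add: q_def ran_pcomp[of "pinv u \<cdot> p"] rp)
  have "|X - \<Sigma> - dom q| =o |X - \<Sigma> - ran q|"
    unfolding dq rq using u(3) v(3) ordIso_symmetric ordIso_transitive by blast
  then obtain s where s: "s \<in> pointwise_stabiliser X \<Sigma>" "q \<subseteq>\<^sub>m s"
    using exists_stabiliser_extension[OF qI _ _ \<Sigma>] u(2) v(2) dq rq by auto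
  have "u \<cdot> s \<cdot> pinv v = p"
  proof (rule map_eqI_Some)
    fix x w
    have step: "(u \<cdot> s \<cdot> pinv v) x = p x" if x: "x \<in> X"
    proof -
      obtain y where y: "u x = Some y" using x uD(3) by blast
      obtain w where w: "p x = Some w" using x pd by blast
      obtain z where z: "v w = Some z" using sym_inv_monoidD(2)[OF pI w] vD(3) by blast
      have "q y = Some z" using y w z qe by blast
      then have "s y = Some z" using s(2) by (metis domI map_le_def)
      then have "(u \<cdot> s \<cdot> pinv v) x = Some w"
        using y z vD(2) by (auto simp: pcomp_eq_Some_iff pinv_eq_Some_iff)
      then show ?thesis using w by simp
    qed
    have "x \<in> X" if "(u \<cdot> s \<cdot> pinv v) x = Some w"
      using that sym_inv_monoidD(1)[OF uD(2)] by (auto simp: pcomp_eq_Some_iff)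
    then show "(u \<cdot> s \<cdot> pinv v) x = Some w \<longleftrightarrow> p x = Some w"
      using step sym_inv_monoidD(1)[OF pI, of x w] by metis
  qed
  moreover have "u \<cdot> s \<cdot> pinv v \<in> M"
    using uD(1) s(1) stab vM subsemigroupD(2)[OF M] by blast
  ultimately show "p \<in> M" by simp
qed

section \<open>The classification\<close>

lemma sym_groupD:
  assumes "p \<in> sym_group X" shows "p \<in> sym_inv_monoid X" "dom p = X" "ran p = X"
  using assms by (simp_all add: sym_group_def)

lemma total_large_rank:
  assumes "f \<in> sym_inv_monoid X" "dom f = X" shows "f \<notin> small_rank X"
  using card_dom_ordIso_ran[OF assms(1)] assms(2) not_ordLess_ordIso ordIso_symmetric
  by (auto simp: mem_small_rank_iff)

lemma total_mem_P_set_iff: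
  assumes "f \<in> sym_inv_monoid X" "dom f = X" "\<Gamma> \<subseteq> X" "Card_order \<mu>" "cinfinite \<mu>"
  shows "f \<in> P_set X \<Gamma> \<mu> \<longleftrightarrow> pimage f \<Gamma> = \<Gamma> \<and> defect X f <o \<mu>"
proof -
  have "\<not> \<mu> \<le>o collapse X f"
    using finite_ordLess[of "X - dom f" \<mu>] assms(2,4,5) ordLeq_imp_not_ordLess[of \<mu> "collapse X f"]
    by (auto simp: collapse_def)
  then show ?thesis using assms(1-3) total_large_rank[OF assms(1,2)] by (simp add: mem_P_set_iff)
qed

lemma permutation_mem_P_set_iff:
  assumes "p \<in> sym_group X" "\<Gamma> \<subseteq> X" "Card_order \<mu>" "cinfinite \<mu>"
  shows "p \<in> P_set X \<Gamma> \<mu> \<longleftrightarrow> pimage p \<Gamma> = \<Gamma>"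
proof -
  have "finite (X - ran p)" using sym_groupD(3)[OF assms(1)] by simp
  then have "defect X p <o \<mu>" using finite_ordLess assms(3,4) by (simp add: defect_def)
  then show ?thesis using total_mem_P_set_iff[OF sym_groupD(1,2)[OF assms(1)] assms(2-4)] by blast
qed

lemma pointwise_stabiliser_subset_P_set:
  assumes "\<Gamma> \<subseteq> \<Sigma>" "\<Sigma> \<subseteq> X" "Card_order \<mu>" "cinfinite \<mu>"
  shows "pointwise_stabiliser X \<Sigma> \<subseteq> P_set X \<Gamma> \<mu>"
proof
  fix s assume s: "s \<in> pointwise_stabiliser X \<Sigma>"
  then have S: "s \<in> sym_group X" and "\<forall>x\<in>\<Gamma>. s x = Some x"
    using assms(1) by (auto simp: pointwise_stabiliser_def)
  then have "pimage s \<Gamma> = \<Gamma>" by (auto simp: mem_pimage_iff)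
  then show "s \<in> P_set X \<Gamma> \<mu>"
    using permutation_mem_P_set_iff[OF S _ assms(3,4)] assms(1,2) by blast
qed

text \<open>
  A permutation that moves a point of \<open>\<Gamma>\<close> out of \<open>\<Gamma>\<close> is not in \<open>P\<close>, having full rank and collapse zero.
\<close>

lemma not_sym_group_subset_P_set:
  assumes X: "infinite X" and \<Gamma>: "finite \<Gamma>" "\<Gamma> \<subseteq> X" "\<Gamma> \<noteq> {}" and \<mu>: "Card_order \<mu>" "cinfinite \<mu>"
  shows "\<not> sym_group X \<subseteq> P_set X \<Gamma> \<mu>"
proof -
  obtain x where x: "x \<in> \<Gamma>" using \<Gamma>(3) by blast
  obtain y where y: "y \<in> X" "y \<notin> \<Gamma>" using X \<Gamma>(1) by (meson finite_subset subsetI)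
  have "\<exists>s \<in> pointwise_stabiliser X {}. [x \<mapsto> y] \<subseteq>\<^sub>m s"
  proof (rule exists_stabiliser_extension)
    show "[x \<mapsto> y] \<in> sym_inv_monoid X" using x y(1) \<Gamma>(2) by (auto simp: sym_inv_monoid_def)
    have "|X - {x}| =o |X|" "|X - {y}| =o |X|" by (intro card_of_diff_finite[OF X]; simp)+
    then have "|X - {x}| =o |X - {y}|" using ordIso_symmetric ordIso_transitive by blast
    then show "|X - {} - dom [x \<mapsto> y]| =o |X - {} - ran [x \<mapsto> y]|" by simp
  qed auto
  then obtain s where s: "s \<in> sym_group X" "s x = Some y"
    by (auto simp: pointwise_stabiliser_def map_le_def)
  then have "pimage s \<Gamma> \<noteq> \<Gamma>" using x y(2) mem_pimage_iff[of y s \<Gamma>] by blast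
  then show ?thesis using permutation_mem_P_set_iff[OF s(1) \<Gamma>(2) \<mu>] s(1) by blast
qed

text \<open>
  Splitting \<open>X\<close> into two halves of full size yields a total element with defect \<open>|X|\<close>.
\<close>

lemma P_set_empty_proper:
  assumes X: "infinite X" and \<mu>: "Card_order \<mu>" "cinfinite \<mu>" "\<mu> \<le>o |X|"
  shows "P_set X {} \<mu> \<noteq> sym_inv_monoid X"
proof -
  have "|X <+> X| =o |X|" using card_of_Plus_infinite1[OF X ordLeq_reflexive[OF card_of_Well_order]] .
  then obtain b where b: "bij_betw b (X <+> X) X" using card_of_ordIso by blast
  have inj: "inj_on b (X <+> X)" and onto: "b ` (X <+> X) = X" using b by (simp_all add: bij_betw_def)
  let ?B = "b ` Inl ` X"
  have half: "|b ` i ` X| =o |X|" if "inj_on i X" "i ` X \<subseteq> X <+> X" for i :: "'a \<Rightarrow> 'a + 'a"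
  proof -
    have "inj_on (b \<circ> i) X" using that inj by (simp add: comp_inj_on inj_on_subset)
    then show ?thesis
      by (intro ordIso_symmetric[OF card_of_ordIsoI[of "b \<circ> i"]]) (simp add: bij_betw_def image_comp)
  qed
  have "|?B| =o |X|" by (rule half) auto
  moreover have "?B \<subseteq> X" using onto by blast
  ultimately obtain g where g: "g \<in> sym_inv_monoid X" "dom g = X" "ran g = ?B"
    using exists_total_onto[OF X, of "{}" ?B] by blast
  have "|b ` Inr ` X| =o |X|" by (rule half) auto
  moreover have "b ` Inr ` X \<subseteq> X - ?B"
  proof
    fix z assume "z \<in> b ` Inr ` X"
    then obtain x where x: "x \<in> X" "z = b (Inr x)" by blast
    have "z \<in> X" using x onto by (metis InrI imageI)
    moreover have "z \<notin> ?B"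
    proof
      assume "z \<in> ?B"
      then obtain x' where "x' \<in> X" "b (Inr x) = b (Inl x')" using x(2) by auto
      then show False using inj_onD[OF inj, of "Inr x" "Inl x'"] x(1) by (simp add: InlI InrI)
    qed
    ultimately show "z \<in> X - ?B" by simp
  qed
  ultimately have "|X| \<le>o |X - ?B|"
    by (intro ordIso_ordLeq_trans[OF ordIso_symmetric card_of_mono1])
  then have "\<mu> \<le>o defect X g" using ordLeq_transitive[OF \<mu>(3)] by (simp add: defect_def g(3))
  then have "g \<notin> P_set X {} \<mu>"
    using total_mem_P_set_iff[OF g(1,2) _ \<mu>(1,2), of "{}"] ordLeq_imp_not_ordLess by blast
  then show ?thesis using g(1) by blast
qed

text \<open>
  If \<open>f \<cdot> g\<close> is total, then so is \<open>f\<close>, which is therefore a permutation; this makes \<open>g\<close> total as well.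
\<close>

lemma total_imp_permutation_subsemigroup:
  assumes X: "infinite X"
  defines "T \<equiv> {f \<in> sym_inv_monoid X. dom f = X \<longrightarrow> ran f = X}"
  shows "subsemigroup X T" "sym_group X \<subseteq> T" "T \<noteq> sym_inv_monoid X"
proof -
  have "f \<cdot> g \<in> T" if f: "f \<in> T" and g: "g \<in> T" for f g
  proof -
    have fI: "f \<in> sym_inv_monoid X" and gI: "g \<in> sym_inv_monoid X" using f g by (simp_all add: T_def)
    have "ran (f \<cdot> g) = X" if d: "dom (f \<cdot> g) = X"
    proof -
      have "dom f = X" using d dom_pcomp_subset[of f g] fI unfolding sym_inv_monoid_def by blast
      then have rf: "ran f = X" using f by (simp add: T_def)
      have "X \<subseteq> dom g"
      proof
        fix y assume "y \<in> X"
        then obtain x where x: "f x = Some y" using rf unfolding ran_def by blast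
        then have "x \<in> dom (f \<cdot> g)" using d sym_inv_monoidD(1)[OF fI x] by simp
        then show "y \<in> dom g" using x by (auto simp: pcomp_eq_Some_iff)
      qed
      moreover have "dom g \<subseteq> X" using gI by (simp add: sym_inv_monoid_def)
      ultimately have dg: "dom g = X" by blast
      then have "ran g = X" using g by (simp add: T_def)
      then show ?thesis using pimage_dom[of g] dg rf by (simp add: ran_pcomp)
    qed
    then show ?thesis using pcomp_closed[OF fI gI] by (simp add: T_def)
  qed
  then show "subsemigroup X T" by (simp add: subsemigroup_def T_def)
  show "sym_group X \<subseteq> T" by (auto simp: sym_group_def T_def)
  obtain x where x: "x \<in> X" using infinite_imp_nonempty[OF X] by blast
  have "|X - {x}| =o |X|" by (rule card_of_diff_finite[OF X]) simp
  from exists_total_onto[OF X finite.emptyI empty_subsetI Diff_subset this]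
  obtain g where g: "g \<in> sym_inv_monoid X" "dom g = X" "ran g = X - {x}" by blast
  have "X - {x} \<noteq> X" using x by blast
  then have "g \<notin> T" using g(2,3) by (simp add: T_def)
  then show "T \<noteq> sym_inv_monoid X" using g(1) by blast
qed

text \<open>
  A maximal subsemigroup inside \<open>T\<close> equals \<open>T\<close>; a maximal inverse subsemigroup inside \<open>T\<close> equals
  \<open>T \<inter> pinv ` T\<close>.  Either of these contains the symmetric group.
\<close>

lemma maximal_not_subset:
  assumes max: "maximal_subsemigroup X M \<or> maximal_inverse_subsemigroup X M"
    and M: "\<not> sym_group X \<subseteq> M"
    and T: "subsemigroup X T" "sym_group X \<subseteq> T" "T \<noteq> sym_inv_monoid X"
  shows "\<not> M \<subseteq> T"
proof
  assume MT: "M \<subseteq> T"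
  show False
  proof (cases "maximal_subsemigroup X M")
    case True
    then have "T = M" using MT T unfolding maximal_subsemigroup_def maximal_element_def by blast
    then show False using M T(2) by blast
  next
    case False
    then have mx: "maximal_inverse_subsemigroup X M" using max by blast
    then have "inverse_subsemigroup X M" by (simp add: maximal_inverse_subsemigroup_def maximal_element_def)
    then have "pinv ` M = M" by (rule inverse_subsemigroup_pinv_image)
    then have sub: "M \<subseteq> T \<inter> pinv ` T" using MT image_mono[OF MT, of pinv] by simp
    have "T \<inter> pinv ` T \<noteq> sym_inv_monoid X" using T(3) subsemigroupD(1)[OF T(1)] by blast
    then have "T \<inter> pinv ` T = M"
      using mx sub inverse_subsemigroup_Int_pinv_image[OF T(1)]
      unfolding maximal_inverse_subsemigroup_def maximal_element_def by blast
    moreover have "sym_group X \<subseteq> pinv ` T" using image_mono[OF T(2), of pinv] pinv_image_sym_group[of X] by simp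
    ultimately show False using M T(2) by blast
  qed
qed

text \<open>
  The semigroup in which total elements are permutations, and those of the form \<open>P_set X {} \<mu>\<close> with
  \<open>\<mu> \<le> |X|\<close>, are proper and contain the symmetric group.  Avoiding them is what
  \<open>exists_spreading_element\<close> asks for beyond the admissible pairs.
\<close>

lemma spreading_element_of_uncontained:
  fixes X :: "'a set"
  assumes X: "infinite X" and \<Sigma>: "finite \<Sigma>" "\<Sigma> \<subseteq> X"
    and K: "subsemigroup X K" and stab: "pointwise_stabiliser X \<Sigma> \<subseteq> K"
    and no_over: "\<And>T. \<lbrakk>subsemigroup X T; sym_group X \<subseteq> T; T \<noteq> sym_inv_monoid X\<rbrakk> \<Longrightarrow> \<not> K \<subseteq> T"
    and no_P: "\<And>\<Gamma> \<mu>. admissible X \<Sigma> \<Gamma> \<mu> \<Longrightarrow> \<not> K \<subseteq> P_set X \<Gamma> \<mu>"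
  shows "\<exists>u \<in> total_elements X K. ran u \<inter> \<Sigma> = {} \<and> |X - \<Sigma> - ran u| =o |X|"
proof -
  have "\<not> K \<subseteq> {f \<in> sym_inv_monoid X. dom f = X \<longrightarrow> ran f = X}"
    using no_over total_imp_permutation_subsemigroup[OF X] by blast
  then obtain e where e: "e \<in> total_elements X K" "ran e \<noteq> X"
    using subsemigroupD(1)[OF K] unfolding total_elements_def by blast
  have "\<not> K \<subseteq> P_set X \<Gamma> \<mu>"
    if h: "\<Gamma> \<subseteq> \<Sigma>" "Card_order \<mu>" "cinfinite \<mu>" "\<mu> \<le>o cardSuc |X|" "\<Gamma> \<noteq> {} \<or> \<mu> \<le>o |X|"
    for \<Gamma> and \<mu> :: "'a set rel"
  proof (cases "\<Gamma> = {}")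
    case False
    then show ?thesis using no_P h by (simp add: admissible_def)
  next
    case True
    have "pimage p {} = {}" for p :: "'a \<rightharpoonup> 'a" by (simp add: pimage_def)
    then have "sym_group X \<subseteq> P_set X {} \<mu>" using permutation_mem_P_set_iff[OF _ empty_subsetI h(2,3)] by blast
    then show ?thesis
      using no_over[OF subsemigroup_P_set[OF h(2,3)]] P_set_empty_proper[OF X h(2,3)] h(5) True by blast
  qed
  then show ?thesis using exists_spreading_element[OF X \<Sigma> K stab e] by blast
qed

text \<open>
  If \<open>M\<close> were contained in none of these sets, spreading elements of both \<open>M\<close> and \<open>pinv ` M\<close> would exist and
  would force the symmetric group into \<open>M\<close>.
\<close>

lemma maximal_subset_P_set:
  fixes X :: "'a set"
  assumes X: "infinite X" and \<Sigma>: "finite \<Sigma>" "\<Sigma> \<subseteq> X"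
    and max: "maximal_subsemigroup X M \<or> maximal_inverse_subsemigroup X M"
    and stab: "pointwise_stabiliser X \<Sigma> \<subseteq> M" and M: "\<not> sym_group X \<subseteq> M"
  shows "\<exists>\<Gamma> \<mu>. admissible X \<Sigma> \<Gamma> \<mu> \<and> (M \<subseteq> P_set X \<Gamma> \<mu> \<or> M \<subseteq> pinv ` P_set X \<Gamma> \<mu>)"
proof (rule ccontr)
  assume neg: "\<not> ?thesis"
  have semi: "subsemigroup X M"
    using max by (auto simp: maximal_subsemigroup_def maximal_inverse_subsemigroup_def
        maximal_element_def inverse_subsemigroup_def)
  note MI = subsemigroupD(1)[OF semi]
  have flip: "M \<subseteq> pinv ` T" if "pinv ` M \<subseteq> T" for T
    using image_mono[OF that, of pinv] pinv_image_pinv_image[OF MI] by simp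
  note no_over = maximal_not_subset[OF max M]
  obtain u where u: "u \<in> total_elements X M" "ran u \<inter> \<Sigma> = {}" "|X - \<Sigma> - ran u| =o |X|"
    using spreading_element_of_uncontained[OF X \<Sigma> semi stab no_over] neg by blast
  have "pointwise_stabiliser X \<Sigma> \<subseteq> pinv ` M"
    using image_mono[OF stab, of pinv] pinv_image_pointwise_stabiliser[of X \<Sigma>] by simp
  moreover have "\<not> pinv ` M \<subseteq> T"
    if T: "subsemigroup X T" "sym_group X \<subseteq> T" "T \<noteq> sym_inv_monoid X" for T
  proof -
    have "sym_group X \<subseteq> pinv ` T" using image_mono[OF T(2), of pinv] pinv_image_sym_group[of X] by simp
    then have "\<not> M \<subseteq> pinv ` T"
      using no_over[OF subsemigroup_pinv_image[OF T(1)]]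
        pinv_image_neq_sym_inv_monoid[OF subsemigroupD(1)[OF T(1)] T(3)] by blast
    then show ?thesis using flip by blast
  qed
  moreover have "\<not> pinv ` M \<subseteq> P_set X \<Gamma> \<mu>" if "admissible X \<Sigma> \<Gamma> \<mu>" for \<Gamma> \<mu>
    using neg flip that by blast
  ultimately obtain v where
    v: "v \<in> total_elements X (pinv ` M)" "ran v \<inter> \<Sigma> = {}" "|X - \<Sigma> - ran v| =o |X|"
    using spreading_element_of_uncontained[OF X \<Sigma> subsemigroup_pinv_image[OF semi]] by blast
  show False using sym_group_subset[OF \<Sigma>(2) semi stab u v] M by blast
qed

lemma admissibleD:
  assumes "admissible X \<Sigma> \<Gamma> \<mu>" "finite \<Sigma>" "\<Sigma> \<subseteq> X"
  shows "finite \<Gamma>" "\<Gamma> \<subseteq> X" "\<Gamma> \<noteq> {}" "Card_order \<mu>" "cinfinite \<mu>" "\<Gamma> \<subseteq> \<Sigma>"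
  using assms by (auto simp: admissible_def intro: finite_subset)

lemma csum_ordLess_iff:
  assumes "Card_order \<mu>" "cinfinite \<mu>"
  shows "|A| +c |B| <o \<mu> \<longleftrightarrow> |A| <o \<mu> \<and> |B| <o \<mu>"
proof
  assume "|A| +c |B| <o \<mu>"
  then show "|A| <o \<mu> \<and> |B| <o \<mu>"
    using ordLeq_ordLess_trans[OF ordLeq_csum1[OF card_of_Card_order]]
      ordLeq_ordLess_trans[OF ordLeq_csum2[OF card_of_Card_order]] by blast
next
  assume "|A| <o \<mu> \<and> |B| <o \<mu>"
  then show "|A| +c |B| <o \<mu>"
    using card_of_Plus_ordLess_infinite_Field[of \<mu> A B] assms
    by (simp add: csum_def Field_card_of cinfinite_def)
qed

text \<open>
  Of the nine ways of combining the conditions for \<open>P\<close> and for \<open>P\<inverse>\<close>, four are the first four listed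
  here, and \<open>pimage f \<Gamma> = \<Gamma>\<close> on both sides is the fifth.  In the other four either the bounds on
  collapse or defect contradict each other, or a set \<open>\<Gamma>\<close> that \<open>f\<close> maps onto itself would have to leave
  the domain or the range of \<open>f\<close>, which is impossible because \<open>\<Gamma>\<close> is finite.
\<close>

lemma P_set_Int_pinv_image_eq:
  assumes \<Gamma>: "finite \<Gamma>" and \<mu>: "Card_order \<mu>" "cinfinite \<mu>"
  shows "P_set X \<Gamma> \<mu> \<inter> pinv ` P_set X \<Gamma> \<mu> =
            {f \<in> sym_inv_monoid X.
               (\<not> \<Gamma> \<subseteq> dom f \<and> \<not> \<Gamma> \<subseteq> ran f)
               \<or> (\<not> \<Gamma> \<subseteq> dom f \<and> \<mu> \<le>o defect X f)
               \<or> (\<mu> \<le>o collapse X f \<and> \<not> \<Gamma> \<subseteq> ran f)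
               \<or> (\<mu> \<le>o collapse X f \<and> \<mu> \<le>o defect X f)
               \<or> (pimage f \<Gamma> = \<Gamma> \<and> collapse X f +c defect X f <o \<mu>)}
            \<union> small_rank X" (is "_ = ?R")
proof (rule set_eqI)
  fix f
  show "f \<in> P_set X \<Gamma> \<mu> \<inter> pinv ` P_set X \<Gamma> \<mu> \<longleftrightarrow> f \<in> ?R"
  proof (cases "f \<in> sym_inv_monoid X")
    case True
    have "pimage f \<Gamma> = \<Gamma> \<Longrightarrow> \<Gamma> \<subseteq> dom f \<and> \<Gamma> \<subseteq> ran f"
      using finite_pimage_eqD(1,2)[OF True \<Gamma>] by blast
    moreover have "collapse X f <o \<mu> \<longleftrightarrow> \<not> \<mu> \<le>o collapse X f" "defect X f <o \<mu> \<longleftrightarrow> \<not> \<mu> \<le>o defect X f"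
      using card_not_ordLeq_iff[OF \<mu>(1)] by (auto simp: collapse_def defect_def)
    moreover have "collapse X f +c defect X f <o \<mu> \<longleftrightarrow> collapse X f <o \<mu> \<and> defect X f <o \<mu>"
      unfolding collapse_def defect_def by (rule csum_ordLess_iff[OF \<mu>])
    ultimately show ?thesis
      using True unfolding Int_iff mem_P_set_iff mem_pinv_image_P_set_iff[OF \<Gamma>] Un_iff mem_Collect_eq
      by argo
  next
    case False
    then have "f \<notin> small_rank X" by (simp add: small_rank_def)
    then show ?thesis using False by (simp add: mem_P_set_iff)
  qed
qed

theorem theorem3p4:
  fixes X \<Sigma> :: "'a set"
  assumes "infinite X" and "\<Sigma> \<noteq> {}" and "finite \<Sigma>" and "\<Sigma> \<subseteq> X"
  shows
    "{M. maximal_subsemigroup X M \<and> pointwise_stabiliser X \<Sigma> \<subseteq> M \<and> \<not> sym_group X \<subseteq> M}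
       = {P_set X \<Gamma> \<mu> | \<Gamma> \<mu>. admissible X \<Sigma> \<Gamma> \<mu>}
         \<union> {pinv ` P_set X \<Gamma> \<mu> | \<Gamma> \<mu>. admissible X \<Sigma> \<Gamma> \<mu>}
     \<and> (\<forall>\<Gamma> \<mu>. admissible X \<Sigma> \<Gamma> \<mu> \<longrightarrow>
          pinv ` P_set X \<Gamma> \<mu> =
            {f \<in> sym_inv_monoid X.
               \<mu> \<le>o defect X f \<or> \<not> \<Gamma> \<subseteq> ran f \<or> (pimage f \<Gamma> = \<Gamma> \<and> collapse X f <o \<mu>)}
            \<union> small_rank X)
     \<and> {M. maximal_inverse_subsemigroup X M \<and> pointwise_stabiliser X \<Sigma> \<subseteq> M
            \<and> \<not> sym_group X \<subseteq> M}
       = {P_set X \<Gamma> \<mu> \<inter> pinv ` P_set X \<Gamma> \<mu> | \<Gamma> \<mu>. admissible X \<Sigma> \<Gamma> \<mu>}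
     \<and> (\<forall>\<Gamma> \<mu>. admissible X \<Sigma> \<Gamma> \<mu> \<longrightarrow>
          P_set X \<Gamma> \<mu> \<inter> pinv ` P_set X \<Gamma> \<mu> =
            {f \<in> sym_inv_monoid X.
               (\<not> \<Gamma> \<subseteq> dom f \<and> \<not> \<Gamma> \<subseteq> ran f)
               \<or> (\<not> \<Gamma> \<subseteq> dom f \<and> \<mu> \<le>o defect X f)
               \<or> (\<mu> \<le>o collapse X f \<and> \<not> \<Gamma> \<subseteq> ran f)
               \<or> (\<mu> \<le>o collapse X f \<and> \<mu> \<le>o defect X f)
               \<or> (pimage f \<Gamma> = \<Gamma> \<and> collapse X f +c defect X f <o \<mu>)}
            \<union> small_rank X)"
    (is "?maximal = ?P \<union> ?P' \<and> ?inverses \<and> ?maximal_inverse = ?Q \<and> ?intersections")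
proof (intro conjI)
  note X = assms(1) and \<Sigma> = assms(3,4)
  let ?I = "sym_inv_monoid X"
  have semi: "subsemigroup X (P_set X \<Gamma> \<mu>)" if "admissible X \<Sigma> \<Gamma> \<mu>" for \<Gamma> \<mu>
    using subsemigroup_P_set[OF admissibleD(4,5)[OF that \<Sigma>]] .
  have stab: "pointwise_stabiliser X \<Sigma> \<subseteq> P_set X \<Gamma> \<mu> \<inter> pinv ` P_set X \<Gamma> \<mu>"
    if "admissible X \<Sigma> \<Gamma> \<mu>" for \<Gamma> \<mu>
  proof -
    have "pointwise_stabiliser X \<Sigma> \<subseteq> P_set X \<Gamma> \<mu>"
      using pointwise_stabiliser_subset_P_set[OF admissibleD(6)[OF that \<Sigma>] \<Sigma>(2) admissibleD(4,5)[OF that \<Sigma>]] .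
    moreover from image_mono[OF this, of pinv] have "pointwise_stabiliser X \<Sigma> \<subseteq> pinv ` P_set X \<Gamma> \<mu>"
      by (simp add: pinv_image_pointwise_stabiliser)
    ultimately show ?thesis by (rule Int_greatest)
  qed
  have not_sym: "\<not> sym_group X \<subseteq> P_set X \<Gamma> \<mu>" "\<not> sym_group X \<subseteq> pinv ` P_set X \<Gamma> \<mu>"
    if "admissible X \<Sigma> \<Gamma> \<mu>" for \<Gamma> \<mu>
  proof -
    show n: "\<not> sym_group X \<subseteq> P_set X \<Gamma> \<mu>"
      using not_sym_group_subset_P_set[OF X admissibleD(1-5)[OF that \<Sigma>]] .
    show "\<not> sym_group X \<subseteq> pinv ` P_set X \<Gamma> \<mu>"
    proof
      assume "sym_group X \<subseteq> pinv ` P_set X \<Gamma> \<mu>"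
      then have "pinv ` sym_group X \<subseteq> pinv ` pinv ` P_set X \<Gamma> \<mu>" by (rule image_mono)
      then show False
        using n pinv_image_sym_group[of X] pinv_image_pinv_image[OF subsemigroupD(1)[OF semi[OF that]]] by simp
    qed
  qed
  have sym_I: "sym_group X \<subseteq> ?I" by (auto simp: sym_group_def)
  have proper: "P_set X \<Gamma> \<mu> \<noteq> ?I" "pinv ` P_set X \<Gamma> \<mu> \<noteq> ?I" if "admissible X \<Sigma> \<Gamma> \<mu>" for \<Gamma> \<mu>
    using not_sym[OF that] sym_I by auto
  have max: "maximal_subsemigroup X (P_set X \<Gamma> \<mu>)" if "admissible X \<Sigma> \<Gamma> \<mu>" for \<Gamma> \<mu>
  proof -
    have "N = P_set X \<Gamma> \<mu>" if N: "subsemigroup X N" "N \<noteq> ?I" "P_set X \<Gamma> \<mu> \<subseteq> N" for N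
      using P_set_supersemigroup[OF X admissibleD(1-5)[OF \<open>admissible X \<Sigma> \<Gamma> \<mu>\<close> \<Sigma>] N(1,3)] N(2,3) by blast
    then show ?thesis using semi[OF that] proper(1)[OF that]
      unfolding maximal_subsemigroup_def maximal_element_def by blast
  qed
  show "?maximal = ?P \<union> ?P'"
  proof (intro set_eqI iffI)
    fix M assume "M \<in> ?maximal"
    then have M: "maximal_subsemigroup X M" "pointwise_stabiliser X \<Sigma> \<subseteq> M" "\<not> sym_group X \<subseteq> M" by simp_all
    obtain \<Gamma> \<mu> where a: "admissible X \<Sigma> \<Gamma> \<mu>" and "M \<subseteq> P_set X \<Gamma> \<mu> \<or> M \<subseteq> pinv ` P_set X \<Gamma> \<mu>"
      using maximal_subset_P_set[OF X \<Sigma> disjI1[OF M(1)] M(2,3)] by blast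
    then have "P_set X \<Gamma> \<mu> = M \<or> pinv ` P_set X \<Gamma> \<mu> = M"
      using M(1) semi[OF a] subsemigroup_pinv_image[OF semi[OF a]] proper[OF a]
      unfolding maximal_subsemigroup_def maximal_element_def by blast
    then show "M \<in> ?P \<union> ?P'" using a by blast
  next
    fix M assume "M \<in> ?P \<union> ?P'"
    then obtain \<Gamma> \<mu> where a: "admissible X \<Sigma> \<Gamma> \<mu>" and M: "M = P_set X \<Gamma> \<mu> \<or> M = pinv ` P_set X \<Gamma> \<mu>"
      by blast
    then have "maximal_subsemigroup X M" using max[OF a] maximal_subsemigroup_pinv_image by blast
    then show "M \<in> ?maximal" using M stab[OF a] not_sym[OF a] by blast
  qed
  show ?inverses
  proof (intro allI impI set_eqI)
    fix \<Gamma> and \<mu> :: "'a set rel" and f assume "admissible X \<Sigma> \<Gamma> \<mu>"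
    then have "finite \<Gamma>" using admissibleD(1) \<Sigma> by blast
    then show "f \<in> pinv ` P_set X \<Gamma> \<mu> \<longleftrightarrow> f \<in> {f \<in> sym_inv_monoid X.
               \<mu> \<le>o defect X f \<or> \<not> \<Gamma> \<subseteq> ran f \<or> (pimage f \<Gamma> = \<Gamma> \<and> collapse X f <o \<mu>)}
            \<union> small_rank X"
      using mem_pinv_image_P_set_iff[of \<Gamma> f X \<mu>] mem_small_rank_iff[of f X]
      unfolding Un_iff mem_Collect_eq by argo
  qed
  show "?maximal_inverse = ?Q"
  proof (intro set_eqI iffI)
    fix M assume "M \<in> ?maximal_inverse"
    then have M: "maximal_inverse_subsemigroup X M" "pointwise_stabiliser X \<Sigma> \<subseteq> M" "\<not> sym_group X \<subseteq> M"
      by simp_all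
    then have "inverse_subsemigroup X M" by (simp add: maximal_inverse_subsemigroup_def maximal_element_def)
    then have inv: "pinv ` M = M" by (rule inverse_subsemigroup_pinv_image)
    obtain \<Gamma> \<mu> where a: "admissible X \<Sigma> \<Gamma> \<mu>" and sub: "M \<subseteq> P_set X \<Gamma> \<mu> \<or> M \<subseteq> pinv ` P_set X \<Gamma> \<mu>"
      using maximal_subset_P_set[OF X \<Sigma> disjI2[OF M(1)] M(2,3)] by blast
    have P: "pinv ` pinv ` P_set X \<Gamma> \<mu> = P_set X \<Gamma> \<mu>"
      using pinv_image_pinv_image[OF subsemigroupD(1)[OF semi[OF a]]] .
    have "M \<subseteq> P_set X \<Gamma> \<mu> \<inter> pinv ` P_set X \<Gamma> \<mu>"
      using sub
    proof
      assume "M \<subseteq> P_set X \<Gamma> \<mu>"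
      then show ?thesis using image_mono[of M "P_set X \<Gamma> \<mu>" pinv] inv by simp
    next
      assume "M \<subseteq> pinv ` P_set X \<Gamma> \<mu>"
      then show ?thesis using image_mono[of M "pinv ` P_set X \<Gamma> \<mu>" pinv] inv P by simp
    qed
    moreover have "P_set X \<Gamma> \<mu> \<inter> pinv ` P_set X \<Gamma> \<mu> \<noteq> ?I" using not_sym(1)[OF a] sym_I by blast
    ultimately have "P_set X \<Gamma> \<mu> \<inter> pinv ` P_set X \<Gamma> \<mu> = M"
      using M(1) inverse_subsemigroup_Int_pinv_image[OF semi[OF a]]
      unfolding maximal_inverse_subsemigroup_def maximal_element_def by blast
    then show "M \<in> ?Q" using a by blast
  next
    fix M assume "M \<in> ?Q"
    then obtain \<Gamma> \<mu> where a: "admissible X \<Sigma> \<Gamma> \<mu>" and M: "M = P_set X \<Gamma> \<mu> \<inter> pinv ` P_set X \<Gamma> \<mu>" by blast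
    have "N = M" if N: "inverse_subsemigroup X N" "N \<noteq> ?I" "M \<subseteq> N" for N
    proof -
      have "N \<subseteq> P_set X \<Gamma> \<mu>"
        using P_set_Int_pinv_supersemigroup[OF X admissibleD(1-5)[OF a \<Sigma>] N(1)] N(2,3) M by blast
      then have "N \<subseteq> pinv ` P_set X \<Gamma> \<mu>"
        using image_mono[of N "P_set X \<Gamma> \<mu>" pinv] inverse_subsemigroup_pinv_image[OF N(1)] by simp
      with \<open>N \<subseteq> P_set X \<Gamma> \<mu>\<close> show ?thesis using N(3) M by blast
    qed
    moreover have "M \<noteq> ?I" using not_sym(1)[OF a] sym_I M by blast
    ultimately have "maximal_inverse_subsemigroup X M"
      using inverse_subsemigroup_Int_pinv_image[OF semi[OF a]] M
      unfolding maximal_inverse_subsemigroup_def maximal_element_def by blast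
    then show "M \<in> ?maximal_inverse" using M stab[OF a] not_sym(1)[OF a] by blast
  qed
  show ?intersections
    by (intro allI impI P_set_Int_pinv_image_eq) (fact admissibleD[OF _ \<Sigma>])+
qed

end
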